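(* Let $d\in\{2,3\}$ and let $p\ge d-1$ be an integer. Let $\widehat{\Omega}$ be the reference triangle ($d=2$) or the reference tetrahedron ($d=3$), and let $\widetilde{\Omega}=[-1,1]^d$ be the reference quadrilateral or hexahedron. Let $\mathsf{D}_{\eta_1},\dots,\mathsf{D}_{\eta_d}$ be degree $p$ tensor-product SBP diagonal-$\mathsf{E}$ operators on $\widetilde{\Omega}$. For $i\in\{1,\dots,d\}$, let $\mathsf{D}_{\xi_i}=\mathsf{H}^{-1}\mathsf{Q}_{\xi_i}$ be the tensor-product split-simplex (TPSS) derivative operator on $\widehat{\Omega}$, with node set $S_{\widehat{\Omega}}=\{\boldsymbol{\xi}^{(m)}\}_{m=1}^{n_p}$, obtained by mapping these operators from $\widetilde{\Omega}$ to the $d+1$ quadrilateral or hexahedral subdomains of the split simplex $\widehat{\Omega}$ and assembling the results (as defined in the context). Then $\mathsf{D}_{\xi_i}$ is exact for polynomials of total degree up to $p-d+1$, i.e., for every $i\in\{1,\dots,d\}$, every polynomial $\mathcal{P}\in\mathbb{P}^{p-d+1}(\widehat{\Omega})$ and every node $\boldsymbol{\xi}^{(m)}\in S_{\widehat{\Omega}}$, $$\left[\mathsf{D}_{\xi_i}\boldsymbol{p}\right]_m=\frac{\partial \mathcal{P}}{\partial \xi_i}(\boldsymbol{\xi}^{(m)}),$$ where $\boldsymbol{p}\in\mathbb{R}^{n_p}$ is the vector with entries $[\boldsymbol{p}]_m=\mathcal{P}(\boldsymbol{\xi}^{(m)})$.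
   Context: **Polynomials.** $\mathbb{P}^{k}(\widehat{\Omega})$ is the space of polynomials on $\widehat{\Omega}$ of total degree at most $k$. **Reference simplices.** For $d=2$, $\widehat{\Omega}=\{(\xi_1,\xi_2): \xi_1,\xi_2\ge -1,\ \xi_1+\xi_2\le 0\}$. For $d=3$, $\widehat{\Omega}=\{(\xi_1,\xi_2,\xi_3): \xi_1,\xi_2,\xi_3\ge -1,\ \xi_1+\xi_2+\xi_3\le -1\}$. **Splitting.** $\widehat{\Omega}$ is split into $L=d+1$ subdomains $\widehat{\Omega}^{(1)},\dots,\widehat{\Omega}^{(L)}$, one for each vertex of $\widehat{\Omega}$. For the triangle, the centroid is connected to the midpoints of the edges, giving three quadrilaterals; each has as vertices one triangle vertex, the midpoints of the two edges meeting there, and the centroid. For the tetrahedron, the midpoint of each edge is connected to the centroids of the two facets sharing that edge, and the facet centroids are connected to the centroid of the tetrahedron; the resulting planes give four hexahedra. Each has as vertices one tetrahedron vertex, the midpoints of the three edges meeting there, the centroids of the three facets meeting there, and the centroid of the tetrahedron. **Mapping to subdomains.** Let $\boldsymbol{\eta}=(\eta_1,\dots,\eta_d)$ be the coordinates on $\widetilde{\Omega}=[-1,1]^d$. Let $v_1,\dots,v_{2^d}\in\{-1,1\}^d$ be the vertices of $\widetilde{\Omega}$ and $\Psi_\alpha(\boldsymbol{\eta})=2^{-d}\prod_{j=1}^d(1+v_{\alpha,j}\eta_j)$ the bilinear ($d=2$) or trilinear ($d=3$) vertex shape functions. The map $\widetilde{\Omega}\to\widehat{\Omega}^{(\ell)}$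 is $\boldsymbol{\xi}^{(\ell)}(\boldsymbol{\eta})=\sum_{\alpha=1}^{2^d}P^{(\ell)}_\alpha\Psi_\alpha(\boldsymbol{\eta})$, where $P^{(\ell)}_\alpha$ is the vertex of $\widehat{\Omega}^{(\ell)}$ corresponding to $v_\alpha$. The vertices of $\widehat{\Omega}^{(\ell)}$ are matched to those of $\widetilde{\Omega}$ so that edges and faces correspond to edges and faces, the map is bijective, and its Jacobian determinant is positive at each node. Denote by $|\mathcal{J}|$ the determinant of the Jacobian matrix $[\partial\xi^{(\ell)}_i/\partial\eta_j]$ (it depends on $\ell$), and by $\partial\eta_j/\partial\xi_i$ the entries of the inverse of this matrix. All these metric quantities are evaluated exactly. **One-dimensional operator.** A degree $p$ one-dimensional diagonal-norm SBP diagonal-$\mathsf{E}$ operator on $[-1,1]$ consists of $n_1$ distinct nodes in $[-1,1]$, ordered increasingly, with first node $-1$ and last node $1$, and matrices $\mathsf{H}_{1D},\mathsf{Q}_{1D}\in\mathbb{R}^{n_1\times n_1}$ such that: $\mathsf{H}_{1D}$ is diagonal with positive diagonal entries; $\mathsf{Q}_{1D}+\mathsf{Q}_{1D}^T=\boldsymbol{t}_R\boldsymbol{t}_R^T-\boldsymbol{t}_L\boldsymbol{t}_L^T$, where $\boldsymbol{t}_L$ and $\boldsymbol{t}_R$ are the first and last standard basis vectors of $\mathbb{R}^{n_1}$; and $\mathsf{D}_{1D}=\mathsf{H}_{1D}^{-1}\mathsf{Q}_{1D}$ differentiates exactly, at the nodes, every polynomial of degree at most $p$. **Tensor-product operators on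 $\widetilde{\Omega}$.** The nodes are the $n_1^d$ points of the tensor-product grid, ordered with the $\eta_1$ index varying fastest. For $d=2$: $\widetilde{\mathsf{H}}=\mathsf{H}_{1D}\otimes\mathsf{H}_{1D}$, $\mathsf{Q}_{\eta_1}=\mathsf{H}_{1D}\otimes\mathsf{Q}_{1D}$, $\mathsf{Q}_{\eta_2}=\mathsf{Q}_{1D}\otimes\mathsf{H}_{1D}$. For $d=3$: $\widetilde{\mathsf{H}}=\mathsf{H}_{1D}\otimes\mathsf{H}_{1D}\otimes\mathsf{H}_{1D}$, $\mathsf{Q}_{\eta_1}=\mathsf{H}_{1D}\otimes\mathsf{H}_{1D}\otimes\mathsf{Q}_{1D}$, $\mathsf{Q}_{\eta_2}=\mathsf{H}_{1D}\otimes\mathsf{Q}_{1D}\otimes\mathsf{H}_{1D}$, $\mathsf{Q}_{\eta_3}=\mathsf{Q}_{1D}\otimes\mathsf{H}_{1D}\otimes\mathsf{H}_{1D}$. The derivative operators are $\mathsf{D}_{\eta_j}=\widetilde{\mathsf{H}}^{-1}\mathsf{Q}_{\eta_j}$. For each facet $\gamma$ of $\widetilde{\Omega}$, $\mathsf{R}_\gamma\in\mathbb{R}^{n_1^{d-1}\times n_1^d}$ is the 0-1 matrix restricting a vector of nodal values to the nodes lying on $\gamma$ (for instance $\mathsf{R}_\gamma=\mathsf{I}_{n_1}\otimes\boldsymbol{t}_L^T$ for the facet $\eta_1=-1$ when $d=2$), and $\mathsf{B}_\gamma$ is the diagonal matrix of facet quadrature weights: $\mathsf{H}_{1D}$ for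 $d=2$, $\mathsf{H}_{1D}\otimes\mathsf{H}_{1D}$ for $d=3$. **Operators on the subdomain $\widehat{\Omega}^{(\ell)}$.** The nodes $S^{(\ell)}$ are the images of the nodes of $\widetilde{\Omega}$ under $\boldsymbol{\xi}^{(\ell)}$. With $m,n\in\{1,\dots,n_1^d\}$ and a subscript $(m)$ denoting evaluation at the $m$-th node of $\widetilde{\Omega}$ (for $\mathsf{N}$: at the $m$-th node of the facet $\gamma$), define - $\mathsf{H}^{(\ell)}$ diagonal with $[\mathsf{H}^{(\ell)}]_{mm}=[\widetilde{\mathsf{H}}]_{mm}\,|\mathcal{J}|_{(m)}$; - $\mathsf{N}^{(\ell)}_{\xi_i\gamma}$ diagonal with $[\mathsf{N}^{(\ell)}_{\xi_i\gamma}]_{mm}=\sum_{j=1}^d n_{\eta_j}\left(|\mathcal{J}|\,\frac{\partial\eta_j}{\partial\xi_i}\right)_{(m)}$, where $(n_{\eta_1},\dots,n_{\eta_d})$ is the outward unit normal to the facet $\gamma$ of $\widetilde{\Omega}$; - $\mathsf{E}^{(\ell)}_{\xi_i}=\sum_{\gamma}\mathsf{R}_\gamma^T\mathsf{B}_\gamma\mathsf{N}^{(\ell)}_{\xi_i\gamma}\mathsf{R}_\gamma$, the sum being over all facets $\gamma$ of $\widetilde{\Omega}$; - $[\mathsf{S}^{(\ell)}_{\xi_i}]_{mn}=\frac12\sum_{j=1}^d\left(\left(|\mathcal{J}|\frac{\partial\eta_j}{\partial\xi_i}\right)_{(m)}[\mathsf{Q}_{\eta_j}]_{mn}-\left(|\mathcal{J}|\frac{\partial\eta_j}{\partial\xi_i}\right)_{(n)}[\mathsf{Q}_{\eta_j}]_{nm}\right)$;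 - $\mathsf{Q}^{(\ell)}_{\xi_i}=\mathsf{S}^{(\ell)}_{\xi_i}+\frac12\mathsf{E}^{(\ell)}_{\xi_i}$ and $\mathsf{D}^{(\ell)}_{\xi_i}=[\mathsf{H}^{(\ell)}]^{-1}\mathsf{Q}^{(\ell)}_{\xi_i}$. **Assembly (TPSS operator).** The nodes of neighbouring subdomains on shared interfaces are conforming (they coincide). Let $S_{\widehat{\Omega}}=\{\boldsymbol{\xi}^{(m)}\}_{m=1}^{n_p}$ be the set of distinct points in $\bigcup_{\ell=1}^{L}S^{(\ell)}$, with a global index assigned to each. If $\tilde\imath,\tilde\jmath$ are the global indices of the local nodes $i,j$ of $\widehat{\Omega}^{(\ell)}$, let $\mathsf{Z}^{(\ell)}(i,j)\in\mathbb{R}^{n_p\times n_p}$ be the matrix with entry $1$ at position $(\tilde\imath,\tilde\jmath)$ and zeros elsewhere. Then, for $l\in\{1,\dots,d\}$, $$\mathsf{H}=\sum_{\ell=1}^{L}\sum_{i,j=1}^{n_1^d}[\mathsf{H}^{(\ell)}]_{ij}\,\mathsf{Z}^{(\ell)}(i,j),\qquad \mathsf{Q}_{\xi_l}=\sum_{\ell=1}^{L}\sum_{i,j=1}^{n_1^d}[\mathsf{Q}^{(\ell)}_{\xi_l}]_{ij}\,\mathsf{Z}^{(\ell)}(i,j),\qquad \mathsf{D}_{\xi_l}=\mathsf{H}^{-1}\mathsf{Q}_{\xi_l}.$$ *)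

theory Defs
  imports
    "HOL-Analysis.Derivative"
    "Jordan_Normal_Form.Matrix"
    "Jordan_Normal_Form.Determinant"
    "Jordan_Normal_Form.Gauss_Jordan_Elimination"
begin

text \<open>
  All indices (coordinates, nodes, simplex vertices, subdomains) start at 0.  Points of
  \<open>d\<close>-dimensional space are vectors in \<^term>\<open>carrier_vec d\<close>.
\<close>

subsection \<open>Matrix notation\<close>

abbreviation mat_inv :: "real mat \<Rightarrow> real mat" where
  "mat_inv A \<equiv> the (mat_inverse A)"

definition mat_sum :: "nat \<Rightarrow> nat \<Rightarrow> ('a \<Rightarrow> real mat) \<Rightarrow> 'a set \<Rightarrow> real mat" where
  "mat_sum nr nc F A = mat nr nc (\<lambda>ij. \<Sum>a\<in>A. F a $$ ij)"

definition kron :: "real mat \<Rightarrow> real mat \<Rightarrow> real mat" where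
  "kron A B = mat (dim_row A * dim_row B) (dim_col A * dim_col B)
     (\<lambda>(i, j). A $$ (i div dim_row B, j div dim_col B) * B $$ (i mod dim_row B, j mod dim_col B))"

text \<open>\<open>kron_prod F d\<close> is \<open>F (d - 1) \<otimes> \<dots> \<otimes> F 1 \<otimes> F 0\<close>: the factor with index 0 belongs to
  the first coordinate, whose node index varies fastest.\<close>

primrec kron_prod :: "(nat \<Rightarrow> real mat) \<Rightarrow> nat \<Rightarrow> real mat" where
  "kron_prod F 0 = 1\<^sub>m 1"
| "kron_prod F (Suc k) = kron (F k) (kron_prod F k)"

lemma kron_one [simp]: "kron A (1\<^sub>m (Suc 0)) = A"
  by (rule eq_matI) (auto simp: kron_def)

lemma kron_prod_2: "kron_prod F 2 = kron (F 1) (F 0)"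
  by (simp add: numeral_2_eq_2)

lemma kron_prod_3: "kron_prod F 3 = kron (F 2) (kron (F 1) (F 0))"
  by (simp add: numeral_3_eq_3 numeral_2_eq_2)

subsection \<open>Partial derivatives and polynomials\<close>

definition partial_deriv :: "nat \<Rightarrow> (real vec \<Rightarrow> real) \<Rightarrow> real vec \<Rightarrow> real" where
  "partial_deriv i f \<xi> = deriv (\<lambda>t. f (\<xi> |\<^sub>v i \<mapsto> t)) (\<xi> $ i)"

text \<open>Polynomial functions of total degree at most \<open>k\<close> in \<open>d\<close> variables.  They are taken on the
  whole space, so that partial derivatives make sense at boundary points of the simplex.\<close>

definition poly_space :: "nat \<Rightarrow> nat \<Rightarrow> (real vec \<Rightarrow> real) set" where
  "poly_space d k = {f. \<exists>c. \<forall>\<xi>\<in>carrier_vec d.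
     f \<xi> = (\<Sum>a | a \<in> {..<d} \<rightarrow>\<^sub>E {..k} \<and> (\<Sum>j<d. a j) \<le> k. c a * (\<Prod>j<d. (\<xi> $ j) ^ a j))}"

subsection \<open>The reference simplex and its splitting\<close>

definition ref_simplex :: "nat \<Rightarrow> real vec set" where
  "ref_simplex d = {\<xi> \<in> carrier_vec d. (\<forall>i<d. -1 \<le> \<xi> $ i) \<and> (\<Sum>i<d. \<xi> $ i) \<le> 2 - real d}"

definition simplex_vertex :: "nat \<Rightarrow> nat \<Rightarrow> real vec" where
  "simplex_vertex d k = vec d (\<lambda>i. if k = Suc i then 1 else -1)"

definition hull_of :: "nat \<Rightarrow> real vec set \<Rightarrow> real vec set" where
  "hull_of d V = {\<xi> \<in> carrier_vec d. \<exists>w. (\<forall>v\<in>V. 0 \<le> w v) \<and> (\<Sum>v\<in>V. w v) = 1 \<and>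
     (\<forall>i<d. \<xi> $ i = (\<Sum>v\<in>V. w v * v $ i))}"

lemma simplex_vertex_inj: "inj_on (simplex_vertex d) {..d}"
proof (rule inj_onI)
  fix k l assume kl: "k \<in> {..d}" "l \<in> {..d}" and eq: "simplex_vertex d k = simplex_vertex d l"
  have "(k = Suc i) = (l = Suc i)" if "i < d" for i
    using arg_cong[OF eq, of "\<lambda>v. v $ i"] that
    by (simp add: simplex_vertex_def split: if_splits)
  then show "k = l" using kl
    by (metis Suc_le_eq atMost_iff not0_implies_Suc)
qed

lemma ref_simplex_eq_hull: "ref_simplex d = hull_of d (simplex_vertex d ` {..d})"
proof -
  have comb: "(\<Sum>k\<le>d. w k * simplex_vertex d k $ i) = 2 * w (Suc i) - (\<Sum>k\<le>d. w k)"
    if "i < d" for w i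
  proof -
    have "(\<Sum>k\<le>d. w k * simplex_vertex d k $ i)
        = (\<Sum>k\<le>d. (if k = Suc i then 2 * w k else 0) - w k)"
      by (rule sum.cong) (use that in \<open>auto simp: simplex_vertex_def\<close>)
    also have "\<dots> = 2 * w (Suc i) - (\<Sum>k\<le>d. w k)"
      using that by (simp add: sum_subtractf)
    finally show ?thesis .
  qed
  have split0: "(\<Sum>k\<le>d. w k) = w 0 + (\<Sum>i<d. w (Suc i))" for w :: "nat \<Rightarrow> real"
    by (rule sum.atMost_shift)
  show ?thesis
  proof (intro equalityI subsetI)
    fix \<xi> assume xi: "\<xi> \<in> ref_simplex d"
    define w where "w k = (case k of 0 \<Rightarrow> 1 - (\<Sum>i<d. (1 + \<xi> $ i) / 2) | Suc i \<Rightarrow> (1 + \<xi> $ i) / 2)" for k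
    have tot: "(\<Sum>k\<le>d. w k) = 1"
      by (simp add: split0 w_def)
    have nonneg: "0 \<le> w k" if "k \<le> d" for k
    proof (cases k)
      case 0
      then show ?thesis
        using xi by (simp add: w_def ref_simplex_def sum.distrib sum_divide_distrib[symmetric])
    next
      case (Suc i)
      then have "-1 \<le> \<xi> $ i"
        using xi that by (simp add: ref_simplex_def)
      then show ?thesis by (simp add: w_def Suc)
    qed
    define u where "u v = w (the_inv_into {..d} (simplex_vertex d) v)" for v
    have u: "u (simplex_vertex d k) = w k" if "k \<le> d" for k
      using that by (simp add: u_def the_inv_into_f_f[OF simplex_vertex_inj])
    show "\<xi> \<in> hull_of d (simplex_vertex d ` {..d})"
      unfolding hull_of_def mem_Collect_eq
    proof (intro conjI exI[of _ u] ballI allI impI)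
      show "\<xi> \<in> carrier_vec d" using xi by (simp add: ref_simplex_def)
      show "0 \<le> u v" if "v \<in> simplex_vertex d ` {..d}" for v
        using that nonneg u by auto
      show "sum u (simplex_vertex d ` {..d}) = 1"
        by (simp add: sum.reindex[OF simplex_vertex_inj] u tot)
      show "\<xi> $ i = (\<Sum>v\<in>simplex_vertex d ` {..d}. u v * v $ i)" if "i < d" for i
      proof -
        have "w (Suc i) = (1 + \<xi> $ i) / 2" by (simp add: w_def)
        then show ?thesis
          using comb[OF that, of w] tot
          by (simp add: sum.reindex[OF simplex_vertex_inj] u field_simps)
      qed
    qed
  next
    fix \<xi> assume "\<xi> \<in> hull_of d (simplex_vertex d ` {..d})"
    then obtain u where xi: "\<xi> \<in> carrier_vec d"
      and u0: "\<And>k. k \<le> d \<Longrightarrow> 0 \<le> u (simplex_vertex d k)"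
      and u1: "(\<Sum>k\<le>d. u (simplex_vertex d k)) = 1"
      and eq: "\<And>i. i < d \<Longrightarrow> \<xi> $ i = (\<Sum>k\<le>d. u (simplex_vertex d k) * simplex_vertex d k $ i)"
      by (auto simp: hull_of_def sum.reindex[OF simplex_vertex_inj])
    define w where "w k = u (simplex_vertex d k)" for k
    have eq': "\<xi> $ i = 2 * w (Suc i) - 1" if "i < d" for i
      using eq[OF that] comb[OF that, of w] u1 by (simp add: w_def)
    have "w 0 + (\<Sum>i<d. w (Suc i)) = 1"
      using u1 split0[of w] by (simp add: w_def)
    moreover have "(\<Sum>i<d. \<xi> $ i) = 2 * (\<Sum>i<d. w (Suc i)) - real d"
      by (simp add: eq' sum_subtractf sum_distrib_left)
    moreover have w0: "0 \<le> w k" if "k \<le> d" for k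
      using u0[OF that] by (simp add: w_def)
    ultimately have "(\<Sum>i<d. \<xi> $ i) \<le> 2 - real d"
      using w0[OF le0] by linarith
    moreover have "-1 \<le> \<xi> $ i" if "i < d" for i
      using eq'[OF that] w0[of "Suc i"] that by simp
    ultimately show "\<xi> \<in> ref_simplex d"
      using xi by (simp add: ref_simplex_def)
  qed
qed

text \<open>Centroid of the face of the simplex spanned by the vertices with indices in \<open>A\<close>: a vertex,
  an edge midpoint, a facet centroid or the centroid of the simplex.\<close>

definition face_centroid :: "nat \<Rightarrow> nat set \<Rightarrow> real vec" where
  "face_centroid d A = vec d (\<lambda>i. (\<Sum>k\<in>A. simplex_vertex d k $ i) / real (card A))"

text \<open>The vertices of the subdomain at vertex \<open>l\<close> are the centroids of all faces containing that
  vertex.  An edge joins the centroids of two such faces when one of them is a facet of the other.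
  A facet (an edge if \<open>d = 2\<close>) collects the centroids of the faces that contain, or of those that
  do not contain, one fixed other vertex \<open>k\<close>.\<close>

definition sub_faces :: "nat \<Rightarrow> nat \<Rightarrow> nat set set" where
  "sub_faces d l = {A. l \<in> A \<and> A \<subseteq> {..d}}"

definition sub_vertices :: "nat \<Rightarrow> nat \<Rightarrow> real vec set" where
  "sub_vertices d l = face_centroid d ` sub_faces d l"

definition sub_edges :: "nat \<Rightarrow> nat \<Rightarrow> real vec set set" where
  "sub_edges d l = {face_centroid d ` {A, insert k A} | A k. A \<in> sub_faces d l \<and> k \<in> {..d} - A}"

definition sub_facets :: "nat \<Rightarrow> nat \<Rightarrow> real vec set set" where
  "sub_facets d l =
     {face_centroid d ` {A \<in> sub_faces d l. k \<in> A \<longleftrightarrow> b} | k b. k \<in> {..d} - {l}}"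

definition subdomain :: "nat \<Rightarrow> nat \<Rightarrow> real vec set" where
  "subdomain d l = hull_of d (sub_vertices d l)"

subsection \<open>The reference cube and the maps to the subdomains\<close>

definition ref_cube :: "nat \<Rightarrow> real vec set" where
  "ref_cube d = {\<eta> \<in> carrier_vec d. \<forall>i<d. \<eta> $ i \<in> {-1..1}}"

definition cube_vertices :: "nat \<Rightarrow> real vec set" where
  "cube_vertices d = {v \<in> carrier_vec d. \<forall>i<d. v $ i \<in> {-1, 1}}"

definition cube_edges :: "nat \<Rightarrow> real vec set set" where
  "cube_edges d = {{u, v} | u v. u \<in> cube_vertices d \<and> v \<in> cube_vertices d \<and>
     (\<exists>!k. k < d \<and> u $ k \<noteq> v $ k)}"

definition cube_facets :: "nat \<Rightarrow> real vec set set" where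
  "cube_facets d = {{v \<in> cube_vertices d. v $ k = s} | k s. k < d \<and> s \<in> {-1, 1}}"

definition shape_fun :: "nat \<Rightarrow> real vec \<Rightarrow> real vec \<Rightarrow> real" where
  "shape_fun d v \<eta> = (\<Prod>j<d. 1 + v $ j * \<eta> $ j) / 2 ^ d"

text \<open>\<open>P v\<close> is the vertex of the subdomain corresponding to the vertex \<open>v\<close> of the cube.\<close>

definition sub_map :: "nat \<Rightarrow> (real vec \<Rightarrow> real vec) \<Rightarrow> real vec \<Rightarrow> real vec" where
  "sub_map d P \<eta> = vec d (\<lambda>i. \<Sum>v\<in>cube_vertices d. P v $ i * shape_fun d v \<eta>)"

definition jacobian :: "nat \<Rightarrow> (real vec \<Rightarrow> real vec) \<Rightarrow> real vec \<Rightarrow> real mat" where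
  "jacobian d P \<eta> = mat d d (\<lambda>(i, j). partial_deriv j (\<lambda>\<zeta>. sub_map d P \<zeta> $ i) \<eta>)"

definition jac_det :: "nat \<Rightarrow> (real vec \<Rightarrow> real vec) \<Rightarrow> real vec \<Rightarrow> real" where
  "jac_det d P \<eta> = det (jacobian d P \<eta>)"

text \<open>The scaled metric term \<open>|J| \<partial>\<eta>\<^sub>j/\<partial>\<xi>\<^sub>i\<close>.\<close>

definition metric_term :: "nat \<Rightarrow> (real vec \<Rightarrow> real vec) \<Rightarrow> nat \<Rightarrow> nat \<Rightarrow> real vec \<Rightarrow> real" where
  "metric_term d P i j \<eta> = jac_det d P \<eta> * mat_inv (jacobian d P \<eta>) $$ (j, i)"

subsection \<open>One-dimensional and tensor-product SBP operators\<close>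

text \<open>The row vectors \<open>t\<^sub>L\<^sup>T\<close> (for \<open>s = -1\<close>) and \<open>t\<^sub>R\<^sup>T\<close> (for \<open>s = 1\<close>).\<close>

definition end_row :: "nat \<Rightarrow> real \<Rightarrow> real mat" where
  "end_row n s = mat_of_row (unit_vec n (if s = -1 then 0 else n - 1))"

text \<open>Degree \<open>p\<close> diagonal-norm SBP diagonal-E operator on \<open>[-1, 1]\<close> with nodes \<open>x\<close>.\<close>

definition sbp_1d :: "nat \<Rightarrow> nat \<Rightarrow> real vec \<Rightarrow> real mat \<Rightarrow> real mat \<Rightarrow> bool" where
  "sbp_1d p n x H Q \<longleftrightarrow>
     0 < n \<and> x \<in> carrier_vec n \<and> (\<forall>i<n. x $ i \<in> {-1..1}) \<and>
     (\<forall>i j. i < j \<and> j < n \<longrightarrow> x $ i < x $ j) \<and> x $ 0 = -1 \<and> x $ (n - 1) = 1 \<and>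
     H \<in> carrier_mat n n \<and> diagonal_mat H \<and> (\<forall>i<n. 0 < H $$ (i, i)) \<and>
     Q \<in> carrier_mat n n \<and>
     Q + transpose_mat Q =
       transpose_mat (end_row n 1) * end_row n 1 - transpose_mat (end_row n (-1)) * end_row n (-1) \<and>
     (\<forall>q :: real poly. degree q \<le> p \<longrightarrow>
        (mat_inv H * Q) *\<^sub>v vec n (\<lambda>i. poly q (x $ i)) = vec n (\<lambda>i. poly (pderiv q) (x $ i)))"

definition cube_node :: "nat \<Rightarrow> nat \<Rightarrow> real vec \<Rightarrow> nat \<Rightarrow> real vec" where
  "cube_node d n x m = vec d (\<lambda>k. x $ (m div n ^ k mod n))"

definition tp_H :: "nat \<Rightarrow> real mat \<Rightarrow> real mat" where
  "tp_H d H = kron_prod (\<lambda>_. H) d"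

definition tp_Q :: "nat \<Rightarrow> real mat \<Rightarrow> real mat \<Rightarrow> nat \<Rightarrow> real mat" where
  "tp_Q d H Q j = kron_prod (\<lambda>k. if k = j then Q else H) d"

text \<open>A facet of the cube is given by a pair \<open>(k, s)\<close> with \<open>k < d\<close> and \<open>s = -1\<close> or \<open>s = 1\<close>, standing
  for \<open>\<eta>\<^sub>k = s\<close>.  Its nodes are numbered in the order of the rows of the restriction matrix.\<close>

definition facet_indices :: "nat \<Rightarrow> (nat \<times> real) set" where
  "facet_indices d = {..<d} \<times> {-1, 1}"

definition facet_normal :: "nat \<times> real \<Rightarrow> nat \<Rightarrow> real" where
  "facet_normal \<gamma> j = (if j = fst \<gamma> then snd \<gamma> else 0)"

definition facet_node :: "nat \<Rightarrow> nat \<Rightarrow> real vec \<Rightarrow> nat \<times> real \<Rightarrow> nat \<Rightarrow> real vec" where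
  "facet_node d n x \<gamma> m = vec d (\<lambda>k. if k < fst \<gamma> then x $ (m div n ^ k mod n)
     else if k = fst \<gamma> then snd \<gamma> else x $ (m div n ^ (k - 1) mod n))"

definition facet_R :: "nat \<Rightarrow> nat \<Rightarrow> nat \<times> real \<Rightarrow> real mat" where
  "facet_R d n \<gamma> = kron_prod (\<lambda>k. if k = fst \<gamma> then end_row n (snd \<gamma>) else 1\<^sub>m n) d"

definition facet_B :: "nat \<Rightarrow> real mat \<Rightarrow> real mat" where
  "facet_B d H = kron_prod (\<lambda>_. H) (d - 1)"

subsection \<open>Operators on a subdomain\<close>

definition sub_H :: "nat \<Rightarrow> nat \<Rightarrow> real vec \<Rightarrow> real mat \<Rightarrow> (real vec \<Rightarrow> real vec) \<Rightarrow> real mat" where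
  "sub_H d n x H P =
     mat_diag (n ^ d) (\<lambda>m. tp_H d H $$ (m, m) * jac_det d P (cube_node d n x m))"

definition sub_N :: "nat \<Rightarrow> nat \<Rightarrow> real vec \<Rightarrow> (real vec \<Rightarrow> real vec) \<Rightarrow> nat \<Rightarrow> nat \<times> real \<Rightarrow> real mat" where
  "sub_N d n x P i \<gamma> =
     mat_diag (n ^ (d - 1)) (\<lambda>m. \<Sum>j<d. facet_normal \<gamma> j * metric_term d P i j (facet_node d n x \<gamma> m))"

definition sub_E :: "nat \<Rightarrow> nat \<Rightarrow> real vec \<Rightarrow> real mat \<Rightarrow> (real vec \<Rightarrow> real vec) \<Rightarrow> nat \<Rightarrow> real mat" where
  "sub_E d n x H P i = mat_sum (n ^ d) (n ^ d)
     (\<lambda>\<gamma>. transpose_mat (facet_R d n \<gamma>) * facet_B d H * sub_N d n x P i \<gamma> * facet_R d n \<gamma>)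
     (facet_indices d)"

definition sub_S ::
    "nat \<Rightarrow> nat \<Rightarrow> real vec \<Rightarrow> real mat \<Rightarrow> real mat \<Rightarrow> (real vec \<Rightarrow> real vec) \<Rightarrow> nat \<Rightarrow> real mat" where
  "sub_S d n x H Q P i = mat (n ^ d) (n ^ d) (\<lambda>(m, m').
     (\<Sum>j<d. metric_term d P i j (cube_node d n x m) * tp_Q d H Q j $$ (m, m')
           - metric_term d P i j (cube_node d n x m') * tp_Q d H Q j $$ (m', m)) / 2)"

definition sub_Q ::
    "nat \<Rightarrow> nat \<Rightarrow> real vec \<Rightarrow> real mat \<Rightarrow> real mat \<Rightarrow> (real vec \<Rightarrow> real vec) \<Rightarrow> nat \<Rightarrow> real mat" where
  "sub_Q d n x H Q P i = sub_S d n x H Q P i + (1 / 2) \<cdot>\<^sub>m sub_E d n x H P i"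

subsection \<open>Splitting and assembly\<close>

text \<open>\<open>P l v\<close> is the vertex of the \<open>l\<close>-th subdomain corresponding to the cube vertex \<open>v\<close>.\<close>

definition vertex_matching :: "nat \<Rightarrow> nat \<Rightarrow> real vec \<Rightarrow> (nat \<Rightarrow> real vec \<Rightarrow> real vec) \<Rightarrow> bool" where
  "vertex_matching d n x P \<longleftrightarrow> (\<forall>l\<le>d.
     bij_betw (P l) (cube_vertices d) (sub_vertices d l) \<and>
     (\<lambda>e. P l ` e) ` cube_edges d = sub_edges d l \<and>
     (\<lambda>F. P l ` F) ` cube_facets d = sub_facets d l \<and>
     bij_betw (sub_map d (P l)) (ref_cube d) (subdomain d l) \<and>
     (\<forall>m<n ^ d. 0 < jac_det d (P l) (cube_node d n x m)))"

definition sub_nodes :: "nat \<Rightarrow> nat \<Rightarrow> real vec \<Rightarrow> (real vec \<Rightarrow> real vec) \<Rightarrow> real vec set" where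
  "sub_nodes d n x P = (\<lambda>m. sub_map d P (cube_node d n x m)) ` {..<n ^ d}"

text \<open>Any two subdomains of the split simplex share an interface.\<close>

definition conforming :: "nat \<Rightarrow> nat \<Rightarrow> real vec \<Rightarrow> (nat \<Rightarrow> real vec \<Rightarrow> real vec) \<Rightarrow> bool" where
  "conforming d n x P \<longleftrightarrow> (\<forall>l\<le>d. \<forall>l'\<le>d.
     sub_nodes d n x (P l) \<inter> (subdomain d l \<inter> subdomain d l') =
     sub_nodes d n x (P l') \<inter> (subdomain d l \<inter> subdomain d l'))"

definition tpss_nodes :: "nat \<Rightarrow> nat \<Rightarrow> real vec \<Rightarrow> (nat \<Rightarrow> real vec \<Rightarrow> real vec) \<Rightarrow> real vec set" where
  "tpss_nodes d n x P = (\<Union>l\<le>d. sub_nodes d n x (P l))"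

text \<open>\<open>X\<close> is the global numbering: \<open>X a\<close> is the \<open>a\<close>-th of the \<open>np\<close> distinct nodes.\<close>

definition assembly_Z ::
    "nat \<Rightarrow> nat \<Rightarrow> real vec \<Rightarrow> (real vec \<Rightarrow> real vec) \<Rightarrow> nat \<Rightarrow> (nat \<Rightarrow> real vec) \<Rightarrow> nat \<Rightarrow> nat \<Rightarrow> real mat" where
  "assembly_Z d n x P np X i j = mat np np (\<lambda>(a, b).
     if X a = sub_map d P (cube_node d n x i) \<and> X b = sub_map d P (cube_node d n x j) then 1 else 0)"

definition assemble ::
    "nat \<Rightarrow> nat \<Rightarrow> real vec \<Rightarrow> (nat \<Rightarrow> real vec \<Rightarrow> real vec) \<Rightarrow> nat \<Rightarrow> (nat \<Rightarrow> real vec) \<Rightarrow>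
     ((real vec \<Rightarrow> real vec) \<Rightarrow> real mat) \<Rightarrow> real mat" where
  "assemble d n x P np X M = mat_sum np np
     (\<lambda>(l, i, j). M (P l) $$ (i, j) \<cdot>\<^sub>m assembly_Z d n x (P l) np X i j)
     ({..d} \<times> {..<n ^ d} \<times> {..<n ^ d})"

definition tpss_H ::
    "nat \<Rightarrow> nat \<Rightarrow> real vec \<Rightarrow> real mat \<Rightarrow> (nat \<Rightarrow> real vec \<Rightarrow> real vec) \<Rightarrow> nat \<Rightarrow> (nat \<Rightarrow> real vec) \<Rightarrow>
     real mat" where
  "tpss_H d n x H P np X = assemble d n x P np X (sub_H d n x H)"

definition tpss_Q ::
    "nat \<Rightarrow> nat \<Rightarrow> real vec \<Rightarrow> real mat \<Rightarrow> real mat \<Rightarrow> (nat \<Rightarrow> real vec \<Rightarrow> real vec) \<Rightarrow> nat \<Rightarrow>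
     (nat \<Rightarrow> real vec) \<Rightarrow> nat \<Rightarrow> real mat" where
  "tpss_Q d n x H Q P np X i = assemble d n x P np X (\<lambda>P'. sub_Q d n x H Q P' i)"

definition tpss_D ::
    "nat \<Rightarrow> nat \<Rightarrow> real vec \<Rightarrow> real mat \<Rightarrow> real mat \<Rightarrow> (nat \<Rightarrow> real vec \<Rightarrow> real vec) \<Rightarrow> nat \<Rightarrow>
     (nat \<Rightarrow> real vec) \<Rightarrow> nat \<Rightarrow> real mat" where
  "tpss_D d n x H Q P np X i = mat_inv (tpss_H d n x H P np X) * tpss_Q d n x H Q P np X i"

end

theory Submission
  imports Defs
begin

text \<open>
  Why the assembled operator is exact.  Write \<open>A\<^sub>i\<^sub>j\<close> for the scaled metric term
  \<open>|J| \<partial>\<eta>\<^sub>j/\<partial>\<xi>\<^sub>i\<close> of one subdomain, \<open>\<xi>(\<eta>)\<close> for its multilinear map and \<open>F = f \<circ> \<xi>\<close> for the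
  pullback of a polynomial \<open>f\<close> of total degree at most \<open>k = p + 1 - d\<close>.

  The diagonal matrix \<open>E\<close> of the subdomain collects exactly the boundary contributions in
  \<open>Q\<^sub>\<eta>\<^sub>j + Q\<^sub>\<eta>\<^sub>j\<^sup>T\<close>, each multiplied by \<open>A\<^sub>i\<^sub>j\<close> (\<open>sub_E_index\<close>).  Adding half of it to the
  skew-symmetric part turns the operator into the split form
  \<open>Q\<^sub>\<xi>\<^sub>i = 1/2 \<Sum>\<^sub>j (A\<^sub>i\<^sub>j Q\<^sub>\<eta>\<^sub>j + Q\<^sub>\<eta>\<^sub>j A\<^sub>i\<^sub>j)\<close> (\<open>sub_Q_index\<close>), in which \<open>Q\<^sub>\<eta>\<^sub>j\<close> is applied to \<open>F\<close>
  and to \<open>A\<^sub>i\<^sub>j F\<close>.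

  A row of \<open>Q\<^sub>\<eta>\<^sub>j\<close> only sees the nodes on one grid line parallel to the \<open>\<eta>\<^sub>j\<close> axis.  It is therefore
  exact for every function whose restriction to each such line is a polynomial of degree at most \<open>p\<close>
  (\<open>tp_Q_exact\<close>).  On these lines each component of
  \<open>\<xi>\<close> and of its Jacobian is affine, so \<open>F\<close> has degree at most \<open>k\<close>, and \<open>A\<^sub>i\<^sub>j\<close>, a cofactor and thus a
  sum of products of \<open>d - 1\<close> Jacobian entries, has degree at most \<open>d - 1\<close>.  Since
  \<open>k + (d - 1) = p\<close>, both \<open>F\<close> and \<open>A\<^sub>i\<^sub>j F\<close> are differentiated exactly.  This is the
  reason for the loss of \<open>d - 1\<close> degrees.

  The product rule now gives \<open>\<Sum>\<^sub>j A\<^sub>i\<^sub>j \<partial>\<^sub>j F + 1/2 F \<Sum>\<^sub>j \<partial>\<^sub>j A\<^sub>i\<^sub>j\<close>.  The second sum vanishes because the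
  rows of the cofactor matrix of a Jacobian are divergence free (\<open>metric_identity\<close>).  In the first
  sum the chain rule and the cofactor expansion \<open>\<Sum>\<^sub>j A\<^sub>i\<^sub>j \<partial>\<xi>\<^sub>r/\<partial>\<eta>\<^sub>j = \<delta>\<^sub>i\<^sub>r |J|\<close> leave
  \<open>|J| \<partial>f/\<partial>\<xi>\<^sub>i\<close>.  Hence on every subdomain \<open>Q\<^sub>\<xi>\<^sub>i\<close> maps the nodal values of \<open>f\<close> to \<open>H\<close> times the
  nodal values of \<open>\<partial>f/\<partial>\<xi>\<^sub>i\<close> (\<open>sub_Q_exact\<close>).

  Assembly preserves this identity: the row of a global node is the sum of the local rows of all
  local nodes located at that point, and \<open>\<partial>f/\<partial>\<xi>\<^sub>i\<close> has the same value in all of them.  The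
  assembled \<open>H\<close> is diagonal with positive entries, so it can be cancelled (\<open>tpss_D_exact\<close>).
\<close>

section \<open>Digits of grid indices\<close>

text \<open>The node \<open>m\<close> of the grid has the \<open>k\<close>-th coordinate \<open>x $ digit n m k\<close>: base-\<open>n\<close> digits translate between
  the flat numbering of the nodes and multi-indices.\<close>

definition digit :: "nat \<Rightarrow> nat \<Rightarrow> nat \<Rightarrow> nat" where
  "digit n m k = m div n ^ k mod n"

lemma mod_mult_div_mod: "(m mod (a * b * c)) div a mod b = m div a mod (b :: nat)"
proof (cases "a = 0")
  case False
  have "(m mod (a * (b * c))) div a = m div a mod (b * c)"
    using False by (simp add: mod_mult2_eq)
  then show ?thesis by (simp add: mod_mod_cancel mult.assoc)
qed simp

lemma digit_mod: "k < d \<Longrightarrow> digit n (m mod n ^ d) k = digit n m k"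
proof -
  assume "k < d"
  then have "d = Suc k + (d - Suc k)" by simp
  then have "n ^ d = n ^ k * n * n ^ (d - Suc k)"
    by (metis power_add power_Suc2)
  then show ?thesis
    by (simp only: digit_def mod_mult_div_mod)
qed

lemma digit_less: "0 < n \<Longrightarrow> digit n m k < n"
  by (simp add: digit_def)

lemma digit_top: "m < n ^ Suc d \<Longrightarrow> digit n m d = m div n ^ d"
  by (simp add: digit_def less_mult_imp_div_less)

lemma base_pos: "\<lbrakk>m < n ^ d; j < d\<rbrakk> \<Longrightarrow> 0 < (n :: nat)"
  by (cases n) (auto simp: power_0_left)

lemma digits_eqI:
  assumes "m < n ^ d" "m' < n ^ d" "\<And>k. k < d \<Longrightarrow> digit n m k = digit n m' k"
  shows "m = m'"
  using assms
proof (induction d arbitrary: m m')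
  case (Suc d)
  have "0 < n" using Suc.prems(1) by (cases n) auto
  have "m mod n ^ d = m' mod n ^ d"
    by (rule Suc.IH) (use \<open>0 < n\<close> Suc.prems in \<open>auto simp: digit_mod\<close>)
  moreover have "m div n ^ d = m' div n ^ d"
    using Suc.prems(3)[of d] digit_top[OF Suc.prems(1)] digit_top[OF Suc.prems(2)] by simp
  ultimately show ?case by (metis div_mult_mod_eq)
qed auto

text \<open>Together with \<open>digits_eqI\<close> this makes the digits a bijection between \<open>{..<n ^ d}\<close> and
  multi-indices.\<close>

lemma digits_exist:
  assumes "\<And>k. k < d \<Longrightarrow> f k < n"
  shows "\<exists>m < n ^ d. \<forall>k<d. digit n m k = f k"
  using assms
proof (induction d)
  case (Suc d)
  then obtain m where m: "m < n ^ d" "\<And>k. k < d \<Longrightarrow> digit n m k = f k" by auto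
  have fd: "f d < n" using Suc.prems by simp
  then have "0 < n ^ d" by simp
  define m' where "m' = m + f d * n ^ d"
  have "m' < (f d + 1) * n ^ d" using m(1) by (simp add: m'_def)
  also have "\<dots> \<le> n * n ^ d" using fd by (intro mult_right_mono) auto
  finally have less: "m' < n ^ Suc d" by simp
  have "m' mod n ^ d = m" "m' div n ^ d = f d" using m(1) \<open>0 < n ^ d\<close> unfolding m'_def by simp_all
  then have "digit n m' k = f k" if "k < Suc d" for k
    using that m(2) digit_mod[of k d n m'] digit_top[OF less] by (cases "k = d") auto
  with less show ?case by blast
qed auto

text \<open>A nodal sum whose terms vanish off the grid line through node \<open>m\<close> in direction \<open>j\<close> is a
  one-dimensional sum, since the nodes of that line are numbered by their \<open>j\<close>-th digit.\<close>

lemma sum_over_grid_line: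
  fixes g :: "nat \<Rightarrow> real"
  assumes m: "m < n ^ d" and j: "j < d"
    and zero: "\<And>m' k. \<lbrakk>m' < n ^ d; k < d; k \<noteq> j; digit n m' k \<noteq> digit n m k\<rbrakk> \<Longrightarrow> g m' = 0"
    and eq: "\<And>m'. \<lbrakk>m' < n ^ d; \<And>k. \<lbrakk>k < d; k \<noteq> j\<rbrakk> \<Longrightarrow> digit n m' k = digit n m k\<rbrakk>
      \<Longrightarrow> g m' = h (digit n m' j)"
  shows "(\<Sum>m'<n ^ d. g m') = (\<Sum>r<n. h r)"
proof -
  let ?L = "{m'. m' < n ^ d \<and> (\<forall>k<d. k \<noteq> j \<longrightarrow> digit n m' k = digit n m k)}"
  have "0 < n" using m j by (rule base_pos)
  have "(\<Sum>m'<n ^ d. g m') = (\<Sum>m'\<in>?L. g m')"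
    by (rule sum.mono_neutral_right) (use zero in auto)
  also have "\<dots> = (\<Sum>m'\<in>?L. h (digit n m' j))"
    by (rule sum.cong) (use eq in auto)
  also have "\<dots> = (\<Sum>r<n. h r)"
  proof (rule sum.reindex_bij_betw)
    show "bij_betw (\<lambda>m'. digit n m' j) ?L {..<n}"
      unfolding bij_betw_def
    proof (intro conjI inj_onI equalityI subsetI)
      fix a b assume ab: "a \<in> ?L" "b \<in> ?L" "digit n a j = digit n b j"
      have "digit n a k = digit n b k" if "k < d" for k
        using ab that by (cases "k = j") auto
      then show "a = b" using ab by (intro digits_eqI[of a n d b]) auto
    next
      fix r assume "r \<in> (\<lambda>m'. digit n m' j) ` ?L"
      then show "r \<in> {..<n}" using \<open>0 < n\<close> by (auto intro: digit_less)
    next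
      fix r assume r: "r \<in> {..<n}"
      have "\<exists>m' < n ^ d. \<forall>k<d. digit n m' k = (if k = j then r else digit n m k)"
        by (rule digits_exist) (use r \<open>0 < n\<close> in \<open>auto simp: digit_less\<close>)
      then obtain m' where m': "m' < n ^ d" "\<And>k. k < d \<Longrightarrow> digit n m' k = (if k = j then r else digit n m k)"
        by blast
      then have "m' \<in> ?L" "r = digit n m' j" using j by auto
      then show "r \<in> (\<lambda>m'. digit n m' j) ` ?L" by (rule rev_image_eqI)
    qed
  qed
  finally show ?thesis .
qed

section \<open>Entries of Kronecker products\<close>

lemma dim_kron_prod [simp]:
  "dim_row (kron_prod F d) = (\<Prod>k<d. dim_row (F k))"
  "dim_col (kron_prod F d) = (\<Prod>k<d. dim_col (F k))"
  by (induction d) (auto simp: kron_def)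

text \<open>The factors may be rectangular, so that the formula also covers the facet restriction matrices,
  in which one factor has a single row.\<close>

lemma kron_prod_index:
  assumes "i < (\<Prod>k<d. dim_row (F k))" "j < (\<Prod>k<d. dim_col (F k))"
  shows "kron_prod F d $$ (i, j) = (\<Prod>k<d. F k $$
    (i div (\<Prod>l<k. dim_row (F l)) mod dim_row (F k), j div (\<Prod>l<k. dim_col (F l)) mod dim_col (F k)))"
  using assms
proof (induction d arbitrary: i j)
  case (Suc d)
  define R where "R k = (\<Prod>l<k. dim_row (F l))" for k
  define C where "C k = (\<Prod>l<k. dim_col (F l))" for k
  have i: "i < R d * dim_row (F d)" and j: "j < C d * dim_col (F d)"
    using Suc.prems by (simp_all add: R_def C_def)
  have pos: "0 < R d" "0 < C d" using i j by (auto intro: gr0I)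
  have split: "(\<Prod>l<d. f l) = (\<Prod>l<k. f l) * f k * (\<Prod>l\<in>{Suc k..<d}. f l)" if "k < d"
    for k and f :: "nat \<Rightarrow> nat"
  proof -
    have "(\<Prod>l=0..<d. f l) = (\<Prod>l=0..<Suc k. f l) * (\<Prod>l\<in>{Suc k..<d}. f l)"
      by (rule prod.atLeastLessThan_concat[symmetric]) (use that in simp_all)
    then show ?thesis unfolding atLeast0LessThan prod.lessThan_Suc .
  qed
  have red: "(i mod R d) div R k mod dim_row (F k) = i div R k mod dim_row (F k)"
       "(j mod C d) div C k mod dim_col (F k) = j div C k mod dim_col (F k)" if "k < d" for k
  proof -
    have Rd: "R d = R k * dim_row (F k) * (\<Prod>l\<in>{Suc k..<d}. dim_row (F l))"
      and Cd: "C d = C k * dim_col (F k) * (\<Prod>l\<in>{Suc k..<d}. dim_col (F l))"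
      unfolding R_def C_def by (rule split[OF that])+
    show "(i mod R d) div R k mod dim_row (F k) = i div R k mod dim_row (F k)"
      unfolding Rd by (rule mod_mult_div_mod)
    show "(j mod C d) div C k mod dim_col (F k) = j div C k mod dim_col (F k)"
      unfolding Cd by (rule mod_mult_div_mod)
  qed
  have top: "i div R d mod dim_row (F d) = i div R d" "j div C d mod dim_col (F d) = j div C d"
    using less_mult_imp_div_less[of i "dim_row (F d)" "R d"] less_mult_imp_div_less[of j "dim_col (F d)" "C d"] i j
    by (simp_all only: mult.commute[of _ "R d"] mult.commute[of _ "C d"] mod_less)
  have "kron_prod F (Suc d) $$ (i, j) = F d $$ (i div R d, j div C d) * kron_prod F d $$ (i mod R d, j mod C d)"
    using i j by (simp add: kron_def R_def[symmetric] C_def[symmetric] mult.commute)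
  also have "kron_prod F d $$ (i mod R d, j mod C d) = (\<Prod>k<d. F k $$
    ((i mod R d) div R k mod dim_row (F k), (j mod C d) div C k mod dim_col (F k)))"
    unfolding R_def C_def
    by (rule Suc.IH) (use pos in \<open>simp_all add: R_def C_def\<close>)
  also have "\<dots> = (\<Prod>k<d. F k $$ (i div R k mod dim_row (F k), j div C k mod dim_col (F k)))"
    using red by (intro prod.cong) auto
  finally show ?case
    unfolding prod.lessThan_Suc by (simp only: R_def[symmetric] C_def[symmetric] top) (rule mult.commute)
next
  case 0
  then have "i = 0" "j = 0" by simp_all
  then show ?case by simp
qed

lemma kron_prod_square:
  assumes F: "\<And>k. k < d \<Longrightarrow> F k \<in> carrier_mat n n"
  shows "kron_prod F d \<in> carrier_mat (n ^ d) (n ^ d)"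
    and "\<lbrakk>i < n ^ d; j < n ^ d\<rbrakk> \<Longrightarrow> kron_prod F d $$ (i, j) = (\<Prod>k<d. F k $$ (digit n i k, digit n j k))"
proof -
  have dims: "(\<Prod>l<k. dim_row (F l)) = n ^ k" "(\<Prod>l<k. dim_col (F l)) = n ^ k" if "k \<le> d" for k
  proof -
    have Fl: "F l \<in> carrier_mat n n" if "l \<in> {..<k}" for l
      by (rule F) (use that \<open>k \<le> d\<close> in simp)
    have "(\<Prod>l<k. dim_row (F l)) = (\<Prod>l<k. n)" "(\<Prod>l<k. dim_col (F l)) = (\<Prod>l<k. n)"
      using carrier_matD[OF Fl] by (simp_all only: cong: prod.cong)
    then show "(\<Prod>l<k. dim_row (F l)) = n ^ k" "(\<Prod>l<k. dim_col (F l)) = n ^ k"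
      by (simp_all only: prod_constant card_lessThan)
  qed
  show "kron_prod F d \<in> carrier_mat (n ^ d) (n ^ d)"
    by (rule carrier_matI) (simp_all only: dim_kron_prod dims order_refl)
  show "kron_prod F d $$ (i, j) = (\<Prod>k<d. F k $$ (digit n i k, digit n j k))" if "i < n ^ d" "j < n ^ d"
  proof -
    have "kron_prod F d $$ (i, j) = (\<Prod>k<d. F k $$
    (i div (\<Prod>l<k. dim_row (F l)) mod dim_row (F k), j div (\<Prod>l<k. dim_col (F l)) mod dim_col (F k)))"
      by (rule kron_prod_index) (simp_all only: dims that order_refl)
    also have "\<dots> = (\<Prod>k<d. F k $$ (digit n i k, digit n j k))"
    proof (rule prod.cong[OF refl])
      fix k assume k: "k \<in> {..<d}"
      then have "F k \<in> carrier_mat n n" "k \<le> d" using F by simp_all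
      then show "F k $$ (i div (\<Prod>l<k. dim_row (F l)) mod dim_row (F k),
          j div (\<Prod>l<k. dim_col (F l)) mod dim_col (F k)) = F k $$ (digit n i k, digit n j k)"
        by (simp only: dims digit_def carrier_matD)
    qed
    finally show ?thesis .
  qed
qed

lemma tp_H_carrier: "H \<in> carrier_mat n n \<Longrightarrow> tp_H d H \<in> carrier_mat (n ^ d) (n ^ d)"
  unfolding tp_H_def by (rule kron_prod_square)

lemma tp_H_index:
  "\<lbrakk>H \<in> carrier_mat n n; m < n ^ d; m' < n ^ d\<rbrakk> \<Longrightarrow> tp_H d H $$ (m, m') = (\<Prod>k<d. H $$ (digit n m k, digit n m' k))"
  unfolding tp_H_def by (rule kron_prod_square)

lemma tp_H_diagonal:
  assumes "H \<in> carrier_mat n n" "diagonal_mat H"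
  shows "diagonal_mat (tp_H d H)"
  unfolding diagonal_mat_def
proof (intro allI impI)
  fix i j assume "i < dim_row (tp_H d H)" "j < dim_col (tp_H d H)" and neq: "i \<noteq> j"
  then have ij: "i < n ^ d" "j < n ^ d" using carrier_matD[OF tp_H_carrier[OF assms(1), of d]] by simp_all
  then obtain k where k: "k < d" "digit n i k \<noteq> digit n j k"
    using neq digits_eqI[OF ij] by blast
  have "0 < n" using base_pos[OF ij(1) k(1)] .
  then have "H $$ (digit n i k, digit n j k) = 0"
    using assms k(2) digit_less[of n i k] digit_less[of n j k] by (auto simp: diagonal_mat_def)
  then have "(\<Prod>k<d. H $$ (digit n i k, digit n j k)) = 0"
    using k(1) by (intro prod_zero) auto
  then show "tp_H d H $$ (i, j) = 0"
    by (simp only: tp_H_index[OF assms(1) ij])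
qed

lemma tp_Q_index:
  assumes "H \<in> carrier_mat n n" "Q \<in> carrier_mat n n" "j < d" "m < n ^ d" "m' < n ^ d"
  shows "tp_Q d H Q j $$ (m, m') = Q $$ (digit n m j, digit n m' j) *
    (\<Prod>k\<in>{..<d} - {j}. H $$ (digit n m k, digit n m' k))"
proof -
  have "tp_Q d H Q j $$ (m, m') = (\<Prod>k<d. (if k = j then Q else H) $$ (digit n m k, digit n m' k))"
    unfolding tp_Q_def by (rule kron_prod_square) (use assms in auto)
  also have "\<dots> = (if j = j then Q else H) $$ (digit n m j, digit n m' j) *
    (\<Prod>k\<in>{..<d} - {j}. (if k = j then Q else H) $$ (digit n m k, digit n m' k))"
    by (rule prod.remove) (use assms in auto)
  also have "\<dots> = Q $$ (digit n m j, digit n m' j) * (\<Prod>k\<in>{..<d} - {j}. H $$ (digit n m k, digit n m' k))"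
    by (intro arg_cong2[where f = "(*)"] prod.cong) auto
  finally show ?thesis .
qed

section \<open>Tensor-product derivatives act along grid lines\<close>

lemma cube_node_carrier [simp]: "cube_node d n x m \<in> carrier_vec d"
  by (simp add: cube_node_def)

lemma cube_node_index: "k < d \<Longrightarrow> cube_node d n x m $ k = x $ digit n m k"
  by (simp add: cube_node_def digit_def)

text \<open>All factors other than the \<open>j\<close>-th are diagonal, which confines row \<open>m\<close> to the grid line through node \<open>m\<close>
  in direction \<open>j\<close>.\<close>

lemma tp_Q_apply:
  assumes H: "H \<in> carrier_mat n n" "diagonal_mat H" and Q: "Q \<in> carrier_mat n n"
    and j: "j < d" and m: "m < n ^ d"
  shows "(\<Sum>m'<n ^ d. tp_Q d H Q j $$ (m, m') * g (cube_node d n x m')) =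
    (\<Prod>k\<in>{..<d} - {j}. H $$ (digit n m k, digit n m k)) *
    (\<Sum>r<n. Q $$ (digit n m j, r) * g (cube_node d n x m |\<^sub>v j \<mapsto> (x $ r)))"
proof -
  let ?w = "\<Prod>k\<in>{..<d} - {j}. H $$ (digit n m k, digit n m k)"
  have "0 < n" using m j by (rule base_pos)
  have "(\<Sum>m'<n ^ d. tp_Q d H Q j $$ (m, m') * g (cube_node d n x m')) =
     (\<Sum>r<n. ?w * (Q $$ (digit n m j, r) * g (cube_node d n x m |\<^sub>v j \<mapsto> (x $ r))))"
  proof (rule sum_over_grid_line[OF m j])
    fix m' k assume a: "m' < n ^ d" "k < d" "k \<noteq> j" "digit n m' k \<noteq> digit n m k"
    have "H $$ (digit n m k, digit n m' k) = 0"
      using H a(4) digit_less[OF \<open>0 < n\<close>, of m k] digit_less[OF \<open>0 < n\<close>, of m' k]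
      by (auto simp: diagonal_mat_def)
    then have "(\<Prod>k\<in>{..<d} - {j}. H $$ (digit n m k, digit n m' k)) = 0"
      using a by (intro prod_zero) auto
    then show "tp_Q d H Q j $$ (m, m') * g (cube_node d n x m') = 0"
      by (simp only: tp_Q_index[OF H(1) Q j m a(1)] mult_zero_right mult_zero_left)
  next
    fix m' assume a: "m' < n ^ d" "\<And>k. \<lbrakk>k < d; k \<noteq> j\<rbrakk> \<Longrightarrow> digit n m' k = digit n m k"
    have "(\<Prod>k\<in>{..<d} - {j}. H $$ (digit n m k, digit n m' k)) = ?w"
      by (rule prod.cong) (use a in auto)
    moreover have "cube_node d n x m' = cube_node d n x m |\<^sub>v j \<mapsto> (x $ digit n m' j)"
      by (rule eq_vecI) (use a(2) in \<open>auto simp: update_vec_def cube_node_def digit_def\<close>)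
    ultimately show "tp_Q d H Q j $$ (m, m') * g (cube_node d n x m') =
      ?w * (Q $$ (digit n m j, digit n m' j) * g (cube_node d n x m |\<^sub>v j \<mapsto> (x $ digit n m' j)))"
      by (simp only: tp_Q_index[OF H(1) Q j m a(1)] mult_ac)
  qed
  then show ?thesis by (simp only: sum_distrib_left)
qed

text \<open>Only the end points of the grid lines survive in \<open>Q\<^sub>\<eta>\<^sub>j + Q\<^sub>\<eta>\<^sub>j\<^sup>T\<close>, on the diagonal; \<open>e\<close> stands for
  the diagonal of \<open>Q + Q\<^sup>T\<close> in one dimension.\<close>

lemma tp_Q_symmetric_part:
  assumes H: "H \<in> carrier_mat n n" "diagonal_mat H" and Q: "Q \<in> carrier_mat n n"
    and j: "j < d" and m: "m < n ^ d" and m': "m' < n ^ d"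
    and QE: "\<And>a b. \<lbrakk>a < n; b < n\<rbrakk> \<Longrightarrow> Q $$ (a, b) + Q $$ (b, a) = (if a = b then e a else 0)"
  shows "tp_Q d H Q j $$ (m, m') + tp_Q d H Q j $$ (m', m) =
    (if m = m' then e (digit n m j) * (\<Prod>k\<in>{..<d} - {j}. H $$ (digit n m k, digit n m k)) else 0)"
proof -
  have "0 < n" using m j by (rule base_pos)
  have off: "H $$ (digit n a k, digit n b k) = 0" if "digit n a k \<noteq> digit n b k" for a b k
    using H that digit_less[OF \<open>0 < n\<close>, of a k] digit_less[OF \<open>0 < n\<close>, of b k]
    by (auto simp: diagonal_mat_def)
  show ?thesis
  proof (cases "\<forall>k<d. k \<noteq> j \<longrightarrow> digit n m k = digit n m' k")
    case True
    then have "(m = m') = (digit n m j = digit n m' j)"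
      using digits_eqI[OF m m'] by (metis (full_types))
    moreover have "(\<Prod>k\<in>{..<d} - {j}. H $$ (digit n m k, digit n m' k)) =
      (\<Prod>k\<in>{..<d} - {j}. H $$ (digit n m k, digit n m k))"
      "(\<Prod>k\<in>{..<d} - {j}. H $$ (digit n m' k, digit n m k)) =
      (\<Prod>k\<in>{..<d} - {j}. H $$ (digit n m k, digit n m k))"
      by (rule prod.cong; use True in simp)+
    ultimately show ?thesis
      using QE[OF digit_less[OF \<open>0 < n\<close>] digit_less[OF \<open>0 < n\<close>], of m j m' j]
      by (simp add: tp_Q_index[OF H(1) Q j m m'] tp_Q_index[OF H(1) Q j m' m] flip: distrib_right)
  next
    case False
    then obtain k where k: "k < d" "k \<noteq> j" "digit n m k \<noteq> digit n m' k" by blast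
    have "(\<Prod>k\<in>{..<d} - {j}. H $$ (digit n m k, digit n m' k)) = 0"
      using k off[of m k m'] by (intro prod_zero) auto
    moreover have "(\<Prod>k\<in>{..<d} - {j}. H $$ (digit n m' k, digit n m k)) = 0"
      using k off[of m' k m] by (intro prod_zero) auto
    moreover have "m \<noteq> m'" using k by auto
    ultimately show ?thesis
      by (simp only: tp_Q_index[OF H(1) Q j m m'] tp_Q_index[OF H(1) Q j m' m] mult_zero_right add_0 if_False)
  qed
qed

section \<open>Inverses and diagonal matrices\<close>

lemma mat_inv_is_inverse:
  fixes A :: "real mat"
  assumes A: "A \<in> carrier_mat n n" and "det A \<noteq> 0"
  shows "mat_inv A \<in> carrier_mat n n" "A * mat_inv A = 1\<^sub>m n" "mat_inv A * A = 1\<^sub>m n"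
proof -
  have "mat_inverse A \<noteq> None"
    using det_non_zero_imp_unit[OF assms, of "()"] mat_inverse(1)[OF A, of "()"] by blast
  then have "mat_inverse A = Some (mat_inv A)" by auto
  from mat_inverse(2)[OF A this]
  show "mat_inv A \<in> carrier_mat n n" "A * mat_inv A = 1\<^sub>m n" "mat_inv A * A = 1\<^sub>m n" by auto
qed

lemma diagonal_det_nonzero:
  fixes A :: "real mat"
  assumes A: "A \<in> carrier_mat n n" "diagonal_mat A" and nz: "\<And>i. i < n \<Longrightarrow> A $$ (i, i) \<noteq> 0"
  shows "det A \<noteq> 0"
proof -
  have "A * mat_diag n (\<lambda>i. inverse (A $$ (i, i))) = 1\<^sub>m n"
    unfolding mat_diag_mult_right[OF A(1)]
    by (rule eq_matI) (use A nz in \<open>auto simp: diagonal_mat_def\<close>)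
  then have "det A * det (mat_diag n (\<lambda>i. inverse (A $$ (i, i)))) = 1"
    using det_mult[OF A(1) mat_diag_dim[of n "\<lambda>i. inverse (A $$ (i, i))"]] by simp
  then show ?thesis by auto
qed

lemma diagonal_row_sum:
  fixes A :: "'a :: semiring_0 mat"
  assumes "A \<in> carrier_mat n n" "diagonal_mat A" "i < n"
  shows "(\<Sum>j<n. A $$ (i, j) * w j) = A $$ (i, i) * w i"
proof -
  have "(\<Sum>j<n. A $$ (i, j) * w j) = (\<Sum>j\<in>{i}. A $$ (i, j) * w j)"
    by (rule sum.mono_neutral_right) (use assms in \<open>auto simp: diagonal_mat_def\<close>)
  then show ?thesis by simp
qed

text \<open>Exactness of \<open>A\<^sup>-\<^sup>1 Q\<close> can be stated and checked row by row without the inverse.  The one-dimensional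
  hypothesis is read and the final claim is proved through this equivalence.\<close>

lemma diagonal_inv_mult_vec_iff:
  fixes A Q :: "real mat"
  assumes A: "A \<in> carrier_mat n n" "diagonal_mat A" and nz: "\<And>i. i < n \<Longrightarrow> A $$ (i, i) \<noteq> 0"
    and Q: "Q \<in> carrier_mat n n"
  shows "(mat_inv A * Q) *\<^sub>v vec n u = vec n w \<longleftrightarrow>
    (\<forall>i<n. (\<Sum>j<n. Q $$ (i, j) * u j) = A $$ (i, i) * w i)"
proof -
  have "det A \<noteq> 0" by (rule diagonal_det_nonzero[OF A]) (rule nz)
  note I = mat_inv_is_inverse[OF A(1) this]
  have B: "mat_inv A * Q \<in> carrier_mat n n" using I(1) Q by (rule mult_carrier_mat)
  have u: "vec n u \<in> carrier_vec n" and w: "vec n w \<in> carrier_vec n" by simp_all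
  have Qu: "Q *\<^sub>v vec n u \<in> carrier_vec n" using Q u by (rule mult_mat_vec_carrier)
  have Bu: "(mat_inv A * Q) *\<^sub>v vec n u = mat_inv A *\<^sub>v (Q *\<^sub>v vec n u)"
    by (rule assoc_mult_mat_vec[OF I(1) Q u])
  have "(mat_inv A * Q) *\<^sub>v vec n u = vec n w \<longleftrightarrow> Q *\<^sub>v vec n u = A *\<^sub>v vec n w"
  proof
    assume "(mat_inv A * Q) *\<^sub>v vec n u = vec n w"
    then have "A *\<^sub>v vec n w = A *\<^sub>v (mat_inv A *\<^sub>v (Q *\<^sub>v vec n u))" using Bu by (simp only:)
    also have "\<dots> = (A * mat_inv A) *\<^sub>v (Q *\<^sub>v vec n u)"
      by (rule assoc_mult_mat_vec[OF A(1) I(1) Qu, symmetric])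
    also have "\<dots> = Q *\<^sub>v vec n u" unfolding I(2) using Qu by (rule one_mult_mat_vec)
    finally show "Q *\<^sub>v vec n u = A *\<^sub>v vec n w" by (rule sym)
  next
    assume "Q *\<^sub>v vec n u = A *\<^sub>v vec n w"
    then have "(mat_inv A * Q) *\<^sub>v vec n u = mat_inv A *\<^sub>v (A *\<^sub>v vec n w)" using Bu by (simp only:)
    also have "\<dots> = (mat_inv A * A) *\<^sub>v vec n w"
      by (rule assoc_mult_mat_vec[OF I(1) A(1) w, symmetric])
    also have "\<dots> = vec n w" unfolding I(3) using w by (rule one_mult_mat_vec)
    finally show "(mat_inv A * Q) *\<^sub>v vec n u = vec n w" .
  qed
  also have "\<dots> \<longleftrightarrow> (\<forall>i<n. (Q *\<^sub>v vec n u) $ i = (A *\<^sub>v vec n w) $ i)"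
    using Q A(1) by (auto intro!: eq_vecI simp del: index_mult_mat_vec)
  also have "\<dots> \<longleftrightarrow> (\<forall>i<n. (\<Sum>j<n. Q $$ (i, j) * u j) = (\<Sum>j<n. A $$ (i, j) * w j))"
    using Q A(1) by (simp add: scalar_prod_def lessThan_atLeast0)
  finally show ?thesis by (simp add: diagonal_row_sum[OF A])
qed

lemma diagonal_congruence_index:
  fixes R B :: "real mat"
  assumes R: "R \<in> carrier_mat N M" and B: "B \<in> carrier_mat N N" "diagonal_mat B"
    and m: "m < M" "m' < M"
  shows "(transpose_mat R * B * mat_diag N f * R) $$ (m, m') =
    (\<Sum>\<mu><N. R $$ (\<mu>, m) * B $$ (\<mu>, \<mu>) * f \<mu> * R $$ (\<mu>, m'))"
proof -
  have T: "transpose_mat R \<in> carrier_mat M N" using R by simp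
  have TB: "transpose_mat R * B \<in> carrier_mat M N" by (rule mult_carrier_mat[OF T B(1)])
  have TBi: "(transpose_mat R * B) $$ (m, \<mu>) = R $$ (\<mu>, m) * B $$ (\<mu>, \<mu>)" if \<mu>: "\<mu> < N" for \<mu>
  proof -
    have "(transpose_mat R * B) $$ (m, \<mu>) = (\<Sum>\<nu><N. R $$ (\<nu>, m) * B $$ (\<nu>, \<mu>))"
      using R B(1) m \<mu> by (simp add: scalar_prod_def lessThan_atLeast0)
    also have "\<dots> = (\<Sum>\<nu>\<in>{\<mu>}. R $$ (\<nu>, m) * B $$ (\<nu>, \<mu>))"
      by (rule sum.mono_neutral_right) (use B \<mu> in \<open>auto simp: diagonal_mat_def\<close>)
    finally show ?thesis by simp
  qed
  have "(transpose_mat R * B * mat_diag N f * R) $$ (m, m') =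
    (\<Sum>\<mu><N. (transpose_mat R * B) $$ (m, \<mu>) * f \<mu> * R $$ (\<mu>, m'))"
    unfolding mat_diag_mult_right[OF TB]
    using R m by (simp add: scalar_prod_def lessThan_atLeast0 del: index_mult_mat(1) cong: sum.cong_simp)
      (simp add: scalar_prod_def)
  also have "\<dots> = (\<Sum>\<mu><N. R $$ (\<mu>, m) * B $$ (\<mu>, \<mu>) * f \<mu> * R $$ (\<mu>, m'))"
    by (rule sum.cong[OF refl]) (simp only: TBi lessThan_iff)
  finally show ?thesis .
qed

section \<open>Functions that are polynomial along coordinate lines\<close>

text \<open>Differentiability along one axis is all that \<^const>\<open>partial_deriv\<close> involves.\<close>

abbreviation has_partial :: "(real vec \<Rightarrow> real) \<Rightarrow> real \<Rightarrow> nat \<Rightarrow> real vec \<Rightarrow> bool" where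
  "has_partial f D j \<eta> \<equiv> ((\<lambda>t. f (\<eta> |\<^sub>v j \<mapsto> t)) has_real_derivative D) (at (\<eta> $ j))"

lemma partial_deriv_eqI: "has_partial f D j \<eta> \<Longrightarrow> partial_deriv j f \<eta> = D"
  unfolding partial_deriv_def by (rule DERIV_imp_deriv)

lemma update_vec_carrier [simp]: "(\<eta> |\<^sub>v j \<mapsto> t) \<in> carrier_vec d \<longleftrightarrow> \<eta> \<in> carrier_vec d"
  unfolding carrier_vec_def mem_Collect_eq dim_update_vec ..

lemma update_vec_index: "k < dim_vec \<eta> \<Longrightarrow> (\<eta> |\<^sub>v j \<mapsto> t) $ k = (if k = j then t else \<eta> $ k)"
  by (simp add: update_vec_def)

lemma update_vec_same: "(\<eta> |\<^sub>v j \<mapsto> (\<eta> $ j)) = \<eta>"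
  by (rule eq_vecI) (auto simp: update_vec_def)

text \<open>Degree at most \<open>k\<close> in each coordinate separately.  The coefficients may depend in any way on the
  remaining coordinates, because operators that act along grid lines cannot detect this dependence.\<close>

definition coord_poly :: "nat \<Rightarrow> nat \<Rightarrow> (real vec \<Rightarrow> real) \<Rightarrow> bool" where
  "coord_poly d k g \<longleftrightarrow> (\<forall>\<eta>\<in>carrier_vec d. \<forall>j<d.
     \<exists>q :: real poly. degree q \<le> k \<and> (\<forall>t. g (\<eta> |\<^sub>v j \<mapsto> t) = poly q t))"

lemma coord_polyE:
  assumes "coord_poly d k g" "\<eta> \<in> carrier_vec d" "j < d"
  obtains q :: "real poly" where "degree q \<le> k" "\<And>t. g (\<eta> |\<^sub>v j \<mapsto> t) = poly q t"
  using assms unfolding coord_poly_def by blast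

lemma coord_poly_mono: "\<lbrakk>coord_poly d k g; k \<le> k'\<rbrakk> \<Longrightarrow> coord_poly d k' g"
  unfolding coord_poly_def by (meson le_trans)

lemma coord_poly_cong:
  assumes "coord_poly d k g" "\<And>\<eta>. \<eta> \<in> carrier_vec d \<Longrightarrow> h \<eta> = g \<eta>"
  shows "coord_poly d k h"
  using assms unfolding coord_poly_def by simp

lemma coord_poly_const: "coord_poly d k (\<lambda>_. c)"
  unfolding coord_poly_def by (intro ballI allI impI exI[of _ "[:c:]"]) simp

lemma coord_poly_add:
  assumes "coord_poly d k g" "coord_poly d k h"
  shows "coord_poly d k (\<lambda>\<eta>. g \<eta> + h \<eta>)"
  unfolding coord_poly_def
proof (intro ballI allI impI)
  fix \<eta> :: "real vec" and j assume a: "\<eta> \<in> carrier_vec d" "j < d"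
  obtain q where "degree q \<le> k" "\<And>t. g (\<eta> |\<^sub>v j \<mapsto> t) = poly q t"
    using coord_polyE[OF assms(1) a] by blast
  moreover obtain r where "degree r \<le> k" "\<And>t. h (\<eta> |\<^sub>v j \<mapsto> t) = poly r t"
    using coord_polyE[OF assms(2) a] by blast
  ultimately show "\<exists>q. degree q \<le> k \<and> (\<forall>t. g (\<eta> |\<^sub>v j \<mapsto> t) + h (\<eta> |\<^sub>v j \<mapsto> t) = poly q t)"
    by (intro exI[of _ "q + r"]) (simp add: degree_add_le)
qed

lemma coord_poly_mult:
  assumes "coord_poly d k g" "coord_poly d k' h"
  shows "coord_poly d (k + k') (\<lambda>\<eta>. g \<eta> * h \<eta>)"
  unfolding coord_poly_def
proof (intro ballI allI impI)
  fix \<eta> :: "real vec" and j assume a: "\<eta> \<in> carrier_vec d" "j < d"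
  obtain q where q: "degree q \<le> k" "\<And>t. g (\<eta> |\<^sub>v j \<mapsto> t) = poly q t"
    using coord_polyE[OF assms(1) a] by blast
  obtain r where r: "degree r \<le> k'" "\<And>t. h (\<eta> |\<^sub>v j \<mapsto> t) = poly r t"
    using coord_polyE[OF assms(2) a] by blast
  have "degree (q * r) \<le> k + k'"
    using degree_mult_le[of q r] q(1) r(1) by linarith
  then show "\<exists>q. degree q \<le> k + k' \<and> (\<forall>t. g (\<eta> |\<^sub>v j \<mapsto> t) * h (\<eta> |\<^sub>v j \<mapsto> t) = poly q t)"
    using q(2) r(2) by (intro exI[of _ "q * r"]) simp
qed

lemma coord_poly_sum:
  assumes "\<And>i. i \<in> A \<Longrightarrow> coord_poly d k (g i)"
  shows "coord_poly d k (\<lambda>\<eta>. \<Sum>i\<in>A. g i \<eta>)"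
  using assms by (induction A rule: infinite_finite_induct)
    (auto intro: coord_poly_add coord_poly_const)

lemma coord_poly_prod:
  assumes "\<And>i. i \<in> A \<Longrightarrow> coord_poly d (k i) (g i)"
  shows "coord_poly d (\<Sum>i\<in>A. k i) (\<lambda>\<eta>. \<Prod>i\<in>A. g i \<eta>)"
  using assms by (induction A rule: infinite_finite_induct)
    (auto intro: coord_poly_mult coord_poly_const)

lemma coord_poly_power:
  assumes "coord_poly d k g"
  shows "coord_poly d (a * k) (\<lambda>\<eta>. g \<eta> ^ a)"
  using coord_poly_prod[of "{..<a}" d "\<lambda>_. k" "\<lambda>_. g"] assms by simp

lemma coord_poly_has_partial:
  assumes "coord_poly d k g" "\<eta> \<in> carrier_vec d" "j < d"
  shows "has_partial g (partial_deriv j g \<eta>) j \<eta>"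
proof -
  obtain q where q: "\<And>t. g (\<eta> |\<^sub>v j \<mapsto> t) = poly q t"
    using coord_polyE[OF assms] by blast
  have "has_partial g (poly (pderiv q) (\<eta> $ j)) j \<eta>"
    unfolding q by (rule poly_DERIV)
  then show ?thesis by (simp only: partial_deriv_eqI)
qed

lemma partial_deriv_mult:
  assumes "coord_poly d k g" "coord_poly d k' h" "\<eta> \<in> carrier_vec d" "j < d"
  shows "partial_deriv j (\<lambda>\<zeta>. g \<zeta> * h \<zeta>) \<eta> = partial_deriv j g \<eta> * h \<eta> + g \<eta> * partial_deriv j h \<eta>"
proof -
  have "has_partial (\<lambda>\<zeta>. g \<zeta> * h \<zeta>) (partial_deriv j g \<eta> * h (\<eta> |\<^sub>v j \<mapsto> (\<eta> $ j))
      + partial_deriv j h \<eta> * g (\<eta> |\<^sub>v j \<mapsto> (\<eta> $ j))) j \<eta>"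
    by (rule DERIV_mult[OF coord_poly_has_partial coord_poly_has_partial]) (rule assms)+
  then show ?thesis
    by (simp only: partial_deriv_eqI update_vec_same mult.commute)
qed

section \<open>Mixed partial derivatives of the multilinear map\<close>

text \<open>The mixed partial derivative of \<^const>\<open>shape_fun\<close>, taken once in each coordinate of \<open>K\<close>: a factor
  \<open>1 + v\<^sub>k \<eta>\<^sub>k\<close> is replaced by its slope.  Indexing by a set builds in the symmetry of mixed derivatives.\<close>

definition shape_deriv :: "nat \<Rightarrow> real vec \<Rightarrow> nat set \<Rightarrow> real vec \<Rightarrow> real" where
  "shape_deriv d v K \<eta> = (\<Prod>k<d. if k \<in> K then v $ k else 1 + v $ k * \<eta> $ k) / 2 ^ d"

text \<open>The corresponding derivative of the \<open>r\<close>-th component of the map; \<open>K = {}\<close> is the component itself and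
  \<open>K = {c}\<close> an entry of the Jacobian.\<close>

definition map_deriv :: "nat \<Rightarrow> (real vec \<Rightarrow> real vec) \<Rightarrow> nat set \<Rightarrow> nat \<Rightarrow> real vec \<Rightarrow> real" where
  "map_deriv d P K r \<eta> = (\<Sum>v\<in>cube_vertices d. P v $ r * shape_deriv d v K \<eta>)"

lemma sub_map_carrier [simp]: "sub_map d P \<eta> \<in> carrier_vec d"
  by (simp add: sub_map_def)

lemma sub_map_index: "r < d \<Longrightarrow> sub_map d P \<eta> $ r = map_deriv d P {} r \<eta>"
  by (simp add: sub_map_def map_deriv_def shape_fun_def shape_deriv_def)

lemma shape_deriv_line:
  assumes "\<eta> \<in> carrier_vec d" "j < d"
  shows "shape_deriv d v K (\<eta> |\<^sub>v j \<mapsto> t) = (if j \<in> K then v $ j else 1 + v $ j * t) *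
    (\<Prod>k\<in>{..<d} - {j}. if k \<in> K then v $ k else 1 + v $ k * \<eta> $ k) / 2 ^ d"
proof -
  have "(\<Prod>k<d. if k \<in> K then v $ k else 1 + v $ k * (\<eta> |\<^sub>v j \<mapsto> t) $ k) =
    (if j \<in> K then v $ j else 1 + v $ j * (\<eta> |\<^sub>v j \<mapsto> t) $ j) *
    (\<Prod>k\<in>{..<d} - {j}. if k \<in> K then v $ k else 1 + v $ k * (\<eta> |\<^sub>v j \<mapsto> t) $ k)"
    by (rule prod.remove) (use assms in auto)
  also have "(\<Prod>k\<in>{..<d} - {j}. if k \<in> K then v $ k else 1 + v $ k * (\<eta> |\<^sub>v j \<mapsto> t) $ k) =
    (\<Prod>k\<in>{..<d} - {j}. if k \<in> K then v $ k else 1 + v $ k * \<eta> $ k)"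
    by (rule prod.cong) (use assms in \<open>auto simp: update_vec_index\<close>)
  also have "(\<eta> |\<^sub>v j \<mapsto> t) $ j = t"
    using assms by (simp add: update_vec_index)
  finally show ?thesis by (simp only: shape_deriv_def)
qed

lemma coord_poly_shape_deriv: "coord_poly d 1 (shape_deriv d v K)"
  unfolding coord_poly_def
proof (intro ballI allI impI)
  fix \<eta> :: "real vec" and j assume a: "\<eta> \<in> carrier_vec d" "j < d"
  define C where "C = (\<Prod>k\<in>{..<d} - {j}. if k \<in> K then v $ k else 1 + v $ k * \<eta> $ k) / 2 ^ d"
  have line: "shape_deriv d v K (\<eta> |\<^sub>v j \<mapsto> t) = (if j \<in> K then v $ j else 1 + v $ j * t) * C" for t
    unfolding shape_deriv_line[OF a] C_def by simp
  show "\<exists>q. degree q \<le> 1 \<and> (\<forall>t. shape_deriv d v K (\<eta> |\<^sub>v j \<mapsto> t) = poly q t)"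
  proof (intro exI[of _ "if j \<in> K then [:v $ j * C:] else [:C, v $ j * C:]"] conjI allI)
    show "degree (if j \<in> K then [:v $ j * C:] else [:C, v $ j * C:]) \<le> 1" by simp
    show "shape_deriv d v K (\<eta> |\<^sub>v j \<mapsto> t) = poly (if j \<in> K then [:v $ j * C:] else [:C, v $ j * C:]) t" for t
      unfolding line by (simp add: algebra_simps)
  qed
qed

lemma coord_poly_map_deriv: "coord_poly d 1 (map_deriv d P K r)"
proof -
  have "coord_poly d (0 + 1) (\<lambda>\<eta>. P v $ r * shape_deriv d v K \<eta>)" for v
    by (rule coord_poly_mult[OF coord_poly_const coord_poly_shape_deriv])
  then have "coord_poly d 1 (\<lambda>\<eta>. \<Sum>v\<in>cube_vertices d. P v $ r * shape_deriv d v K \<eta>)"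
    by (intro coord_poly_sum) simp
  then show ?thesis by (simp only: map_deriv_def[abs_def])
qed

lemma has_partial_map_deriv:
  assumes "\<eta> \<in> carrier_vec d" "j < d" "j \<notin> K"
  shows "has_partial (map_deriv d P K r) (map_deriv d P (insert j K) r \<eta>) j \<eta>"
proof -
  have shape: "has_partial (shape_deriv d v K) (shape_deriv d v (insert j K) \<eta>) j \<eta>" for v
  proof -
    define C where "C = (\<Prod>k\<in>{..<d} - {j}. if k \<in> K then v $ k else 1 + v $ k * \<eta> $ k) / 2 ^ d"
    have line: "shape_deriv d v K (\<eta> |\<^sub>v j \<mapsto> t) = (1 + v $ j * t) * C" for t
      using assms(3) unfolding shape_deriv_line[OF assms(1,2)] C_def by simp
    have cong: "(\<Prod>k\<in>{..<d} - {j}. if k \<in> insert j K then v $ k else 1 + v $ k * \<eta> $ k) =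
       (\<Prod>k\<in>{..<d} - {j}. if k \<in> K then v $ k else 1 + v $ k * \<eta> $ k)"
      by (rule prod.cong) auto
    have D: "shape_deriv d v (insert j K) \<eta> = v $ j * C"
      using shape_deriv_line[OF assms(1,2), of v "insert j K" "\<eta> $ j"]
      unfolding update_vec_same cong C_def by simp
    show ?thesis unfolding line D by (auto intro!: derivative_eq_intros)
  qed
  show ?thesis
    unfolding map_deriv_def by (intro DERIV_sum DERIV_cmult shape)
qed

lemma jacobian_carrier [simp]: "jacobian d P \<eta> \<in> carrier_mat d d"
  by (simp add: jacobian_def)

lemma jacobian_index:
  assumes "\<eta> \<in> carrier_vec d" "r < d" "c < d"
  shows "jacobian d P \<eta> $$ (r, c) = map_deriv d P {c} r \<eta>"
  using partial_deriv_eqI[OF has_partial_map_deriv[OF assms(1,3), of "{}" P r]] assms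
  by (simp add: jacobian_def sub_map_index)

section \<open>Cofactors and the metric identities\<close>

text \<open>The \<open>(i, j)\<close> cofactor of \<open>A\<close> as the part of the Leibniz formula with \<open>\<sigma> i = j\<close>, without the factor
  \<open>A i j\<close>.  In this
  form its degree is visible, it can be differentiated factor by factor, and permutations can be
  composed with transpositions.\<close>

definition cofactor_sum :: "nat \<Rightarrow> (nat \<Rightarrow> nat \<Rightarrow> 'a :: comm_ring_1) \<Rightarrow> nat \<Rightarrow> nat \<Rightarrow> 'a" where
  "cofactor_sum d A i j = (\<Sum>\<sigma> | \<sigma> permutes {0..<d} \<and> \<sigma> i = j.
     of_int (sign \<sigma>) * (\<Prod>r\<in>{0..<d} - {i}. A r (\<sigma> r)))"

lemma sum_perms_by_image:
  fixes d :: nat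
  assumes "i < d"
  shows "(\<Sum>j<d. \<Sum>\<sigma> | \<sigma> permutes {0..<d} \<and> \<sigma> i = j. f \<sigma> j) = (\<Sum>\<sigma> | \<sigma> permutes {0..<d}. f \<sigma> (\<sigma> i))"
proof -
  have "(\<Sum>j<d. \<Sum>\<sigma> | \<sigma> permutes {0..<d} \<and> \<sigma> i = j. f \<sigma> j) =
    (\<Sum>j<d. \<Sum>\<sigma> | \<sigma> \<in> {\<sigma>. \<sigma> permutes {0..<d}} \<and> \<sigma> i = j. f \<sigma> (\<sigma> i))"
    by (intro sum.cong) auto
  also have "\<dots> = (\<Sum>\<sigma> | \<sigma> permutes {0..<d}. f \<sigma> (\<sigma> i))"
  proof (rule sum.group)
    show "finite {\<sigma>. \<sigma> permutes {0..<d}}" by (rule finite_permutations) simp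
    show "(\<lambda>\<sigma>. \<sigma> i) ` {\<sigma>. \<sigma> permutes {0..<d}} \<subseteq> {..<d}"
      using assms permutes_in_image[of _ "{0..<d}" i] by force
  qed simp
  finally show ?thesis .
qed

lemma cofactor_sum_cong:
  assumes "\<And>r c. \<lbrakk>r < d; c < d\<rbrakk> \<Longrightarrow> A r c = B r c"
  shows "cofactor_sum d A i j = cofactor_sum d B i j"
proof -
  have "\<sigma> r < d" if "\<sigma> permutes {0..<d}" "r < d" for \<sigma> :: "nat \<Rightarrow> nat" and r
    using permutes_in_image[OF that(1), of r] that(2) by simp
  then show ?thesis unfolding cofactor_sum_def
    by (intro sum.cong arg_cong2[where f = "(*)"] prod.cong refl) (use assms in auto)
qed

text \<open>The sum is the Leibniz formula for the matrix in which row \<open>i\<close> is replaced by row \<open>r\<close>, which has two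
  equal rows unless \<open>r = i\<close>.\<close>

lemma cofactor_sum_expansion:
  fixes A :: "nat \<Rightarrow> nat \<Rightarrow> 'a :: comm_ring_1"
  assumes "i < d" "r < d"
  shows "(\<Sum>j<d. A r j * cofactor_sum d A i j) = (if r = i then det (mat d d (\<lambda>(a, b). A a b)) else 0)"
proof -
  define M where "M = mat d d (\<lambda>(a, b). A (if a = i then r else a) b)"
  have M: "M \<in> carrier_mat d d" by (simp add: M_def)
  have "(\<Sum>j<d. A r j * cofactor_sum d A i j) = (\<Sum>j<d. \<Sum>\<sigma> | \<sigma> permutes {0..<d} \<and> \<sigma> i = j.
      A r j * (of_int (sign \<sigma>) * (\<Prod>s\<in>{0..<d} - {i}. A s (\<sigma> s))))"
    by (simp add: cofactor_sum_def sum_distrib_left)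
  also have "\<dots> = (\<Sum>\<sigma> | \<sigma> permutes {0..<d}.
      A r (\<sigma> i) * (of_int (sign \<sigma>) * (\<Prod>s\<in>{0..<d} - {i}. A s (\<sigma> s))))"
    by (rule sum_perms_by_image[OF assms(1)])
  also have "\<dots> = (\<Sum>\<sigma> | \<sigma> permutes {0..<d}. of_int (sign \<sigma>) * (\<Prod>s = 0..<d. M $$ (s, \<sigma> s)))"
  proof (rule sum.cong[OF refl])
    fix \<sigma> assume "\<sigma> \<in> {\<sigma>. \<sigma> permutes {0..<d}}"
    then have \<sigma>: "\<sigma> s < d" if "s < d" for s
      using that permutes_in_image[of \<sigma> "{0..<d}" s] by simp
    have "(\<Prod>s = 0..<d. M $$ (s, \<sigma> s)) = M $$ (i, \<sigma> i) * (\<Prod>s\<in>{0..<d} - {i}. M $$ (s, \<sigma> s))"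
      by (rule prod.remove) (use assms in auto)
    also have "\<dots> = A r (\<sigma> i) * (\<Prod>s\<in>{0..<d} - {i}. A s (\<sigma> s))"
      by (intro arg_cong2[where f = "(*)"] prod.cong) (use assms \<sigma> in \<open>auto simp: M_def\<close>)
    finally show "A r (\<sigma> i) * (of_int (sign \<sigma>) * (\<Prod>s\<in>{0..<d} - {i}. A s (\<sigma> s))) =
      of_int (sign \<sigma>) * (\<Prod>s = 0..<d. M $$ (s, \<sigma> s))"
      by (simp only: mult_ac)
  qed
  also have "\<dots> = det M" by (rule det_def'[OF M, symmetric])
  also have "det M = (if r = i then det (mat d d (\<lambda>(a, b). A a b)) else 0)"
  proof (cases "r = i")
    case True
    then have "M = mat d d (\<lambda>(a, b). A a b)"
      by (auto simp: M_def intro!: eq_matI)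
    then show ?thesis using True by simp
  next
    case False
    have "row M i = row M r"
      by (rule eq_vecI) (use assms in \<open>auto simp: M_def\<close>)
    then show ?thesis
      using det_identical_rows[OF M, of i r] False assms by simp
  qed
  finally show ?thesis .
qed

lemma det_mult_mat_inv_index:
  assumes A: "A \<in> carrier_mat d d" and det: "det A \<noteq> 0" and i: "i < d" and j: "j < d"
  shows "det A * mat_inv A $$ (j, i) = cofactor_sum d (\<lambda>r c. A $$ (r, c)) i j"
proof -
  define C where "C = mat d d (\<lambda>(c, r). cofactor_sum d (\<lambda>r c. A $$ (r, c)) r c)"
  have C: "C \<in> carrier_mat d d" by (simp add: C_def)
  note B = mat_inv_is_inverse[OF A det]
  have matA: "mat d d (\<lambda>(a, b). A $$ (a, b)) = A" by (rule eq_matI) (use A in auto)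
  have AC: "A * C = det A \<cdot>\<^sub>m 1\<^sub>m d"
  proof (rule eq_matI)
    fix r s assume rs: "r < dim_row (det A \<cdot>\<^sub>m 1\<^sub>m d)" "s < dim_col (det A \<cdot>\<^sub>m 1\<^sub>m d)"
    then have "r < d" "s < d" by simp_all
    then have "(A * C) $$ (r, s) = (\<Sum>c<d. A $$ (r, c) * cofactor_sum d (\<lambda>r c. A $$ (r, c)) s c)"
      using A by (simp add: C_def scalar_prod_def lessThan_atLeast0)
    then show "(A * C) $$ (r, s) = (det A \<cdot>\<^sub>m 1\<^sub>m d) $$ (r, s)"
      using cofactor_sum_expansion[of s d r "\<lambda>r c. A $$ (r, c)", unfolded matA] \<open>r < d\<close> \<open>s < d\<close>
      by simp
  qed (use A C in auto)
  have "C = (mat_inv A * A) * C" using B C by simp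
  also have "\<dots> = mat_inv A * (A * C)" by (rule assoc_mult_mat[OF B(1) A C])
  also have "\<dots> = det A \<cdot>\<^sub>m mat_inv A" unfolding AC using B(1) by (simp add: mult_smult_distrib[OF B(1) one_carrier_mat])
  finally have "C $$ (j, i) = (det A \<cdot>\<^sub>m mat_inv A) $$ (j, i)" by simp
  then show ?thesis using B(1) i j by (simp add: C_def)
qed

text \<open>Unlike \<^const>\<open>metric_term\<close>, which depends on the inverse of the Jacobian, this is a polynomial on the
  whole space.  Both agree wherever the Jacobian is invertible, in particular at the nodes.\<close>

definition metric_poly :: "nat \<Rightarrow> (real vec \<Rightarrow> real vec) \<Rightarrow> nat \<Rightarrow> nat \<Rightarrow> real vec \<Rightarrow> real" where
  "metric_poly d P i j \<eta> = cofactor_sum d (\<lambda>r c. map_deriv d P {c} r \<eta>) i j"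

lemma metric_term_eq:
  assumes "\<eta> \<in> carrier_vec d" "i < d" "j < d" "jac_det d P \<eta> \<noteq> 0"
  shows "metric_term d P i j \<eta> = metric_poly d P i j \<eta>"
  unfolding metric_term_def metric_poly_def jac_det_def
  by (subst det_mult_mat_inv_index[OF jacobian_carrier])
     (use assms in \<open>auto simp: jac_det_def jacobian_index intro: cofactor_sum_cong\<close>)

lemma metric_poly_jacobian:
  assumes "\<eta> \<in> carrier_vec d" "i < d" "r < d"
  shows "(\<Sum>j<d. map_deriv d P {j} r \<eta> * metric_poly d P i j \<eta>) = (if r = i then jac_det d P \<eta> else 0)"
proof -
  have "mat d d (\<lambda>(a, b). map_deriv d P {b} a \<eta>) = jacobian d P \<eta>"
    by (rule eq_matI) (use assms in \<open>auto simp: jacobian_index carrier_matD[OF jacobian_carrier]\<close>)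
  then show ?thesis
    using cofactor_sum_expansion[OF assms(2,3), of "\<lambda>r c. map_deriv d P {c} r \<eta>"]
    by (simp add: metric_poly_def jac_det_def)
qed

text \<open>Each summand is a product of \<open>d - 1\<close> Jacobian entries, all affine along coordinate lines.\<close>

lemma coord_poly_metric:
  assumes "i < d"
  shows "coord_poly d (d - 1) (metric_poly d P i j)"
proof -
  have "coord_poly d (0 + (\<Sum>r\<in>{0..<d} - {i}. 1))
    (\<lambda>\<eta>. of_int (sign \<sigma>) * (\<Prod>r\<in>{0..<d} - {i}. map_deriv d P {\<sigma> r} r \<eta>))" for \<sigma>
    by (rule coord_poly_mult[OF coord_poly_const coord_poly_prod]) (rule coord_poly_map_deriv)
  then have "coord_poly d (d - 1) (\<lambda>\<eta>. of_int (sign \<sigma>) * (\<Prod>r\<in>{0..<d} - {i}. map_deriv d P {\<sigma> r} r \<eta>))" for \<sigma>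
    using assms by simp
  then show ?thesis
    unfolding metric_poly_def[abs_def] cofactor_sum_def by (rule coord_poly_sum)
qed

lemma has_partial_metric_poly:
  assumes \<eta>: "\<eta> \<in> carrier_vec d" and i: "i < d" and j: "j < d"
  shows "has_partial (metric_poly d P i j) (\<Sum>\<sigma> | \<sigma> permutes {0..<d} \<and> \<sigma> i = j. of_int (sign \<sigma>) *
    (\<Sum>r\<in>{0..<d} - {i}. map_deriv d P {\<sigma> i, \<sigma> r} r \<eta> *
      (\<Prod>s\<in>{0..<d} - {i} - {r}. map_deriv d P {\<sigma> s} s \<eta>))) j \<eta>"
  unfolding metric_poly_def cofactor_sum_def
proof (intro DERIV_sum DERIV_cmult)
  fix \<sigma> assume "\<sigma> \<in> {\<sigma>. \<sigma> permutes {0..<d} \<and> \<sigma> i = j}"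
  then have \<sigma>: "inj \<sigma>" "\<sigma> i = j" by (auto intro: permutes_inj)
  have "has_partial (\<lambda>\<zeta>. \<Prod>r\<in>{0..<d} - {i}. map_deriv d P {\<sigma> r} r \<zeta>)
    (\<Sum>r\<in>{0..<d} - {i}. map_deriv d P (insert j {\<sigma> r}) r \<eta> *
      (\<Prod>s\<in>{0..<d} - {i} - {r}. map_deriv d P {\<sigma> s} s (\<eta> |\<^sub>v j \<mapsto> (\<eta> $ j)))) j \<eta>"
  proof (rule has_field_derivative_prod)
    fix r assume "r \<in> {0..<d} - {i}"
    then have "j \<notin> {\<sigma> r}" using \<sigma> by (auto dest: injD)
    then show "has_partial (map_deriv d P {\<sigma> r} r) (map_deriv d P (insert j {\<sigma> r}) r \<eta>) j \<eta>"
      by (rule has_partial_map_deriv[OF \<eta> j])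
  qed
  then show "has_partial (\<lambda>\<zeta>. \<Prod>r\<in>{0..<d} - {i}. map_deriv d P {\<sigma> r} r \<zeta>)
    (\<Sum>r\<in>{0..<d} - {i}. map_deriv d P {\<sigma> i, \<sigma> r} r \<eta> *
      (\<Prod>s\<in>{0..<d} - {i} - {r}. map_deriv d P {\<sigma> s} s \<eta>)) j \<eta>"
    by (simp only: update_vec_same \<sigma>(2))
qed

text \<open>By the product rule the divergence is a sum over permutations \<open>\<sigma>\<close> and rows \<open>r \<noteq> i\<close> of terms that contain
  the second derivative of \<open>\<xi>\<^sub>r\<close> in the coordinates \<open>\<sigma> i\<close> and \<open>\<sigma> r\<close>.  Composing \<open>\<sigma>\<close> with the transposition of
  \<open>i\<close> and \<open>r\<close> exchanges these two coordinates: the term stays the same except for the sign of the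
  permutation.  So for each \<open>r\<close> the sum equals its own negative.\<close>

lemma metric_identity:
  assumes \<eta>: "\<eta> \<in> carrier_vec d" and i: "i < d"
  shows "(\<Sum>j<d. partial_deriv j (metric_poly d P i j) \<eta>) = 0"
proof -
  define T where "T \<sigma> r = of_int (sign \<sigma>) * (map_deriv d P {\<sigma> i, \<sigma> r} r \<eta> *
      (\<Prod>s\<in>{0..<d} - {i} - {r}. map_deriv d P {\<sigma> s} s \<eta>))" for \<sigma> r
  \<comment> \<open>Exchanging the images of \<open>i\<close> and \<open>r\<close> fixes everything but the sign of the permutation.\<close>
  have cancel: "(\<Sum>\<sigma> | \<sigma> permutes {0..<d}. T \<sigma> r) = 0" if r: "r \<in> {0..<d} - {i}" for r
  proof -
    have tr: "Transposition.transpose i r permutes {0..<d}"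
      using r i by (intro permutes_swap_id) auto
    have "T (\<sigma> \<circ> Transposition.transpose i r) r = - T \<sigma> r" if \<sigma>: "\<sigma> permutes {0..<d}" for \<sigma>
    proof -
      have "permutation \<sigma>" 
        unfolding permutation_permutes using \<sigma> by (intro exI[of _ "{0..<d}"]) simp
      then have "sign (\<sigma> \<circ> Transposition.transpose i r) = - sign \<sigma>"
        using r by (simp add: sign_compose permutation_swap_id sign_swap_id)
      moreover have "(\<Prod>s\<in>{0..<d} - {i} - {r}. map_deriv d P {(\<sigma> \<circ> Transposition.transpose i r) s} s \<eta>) =
        (\<Prod>s\<in>{0..<d} - {i} - {r}. map_deriv d P {\<sigma> s} s \<eta>)"
        by (rule prod.cong) (auto simp: Transposition.transpose_def)
      moreover have "{(\<sigma> \<circ> Transposition.transpose i r) i, (\<sigma> \<circ> Transposition.transpose i r) r} = {\<sigma> i, \<sigma> r}"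
        by auto
      ultimately show ?thesis
        by (simp only: T_def of_int_minus mult_minus_left)
    qed
    then have "(\<Sum>\<sigma> | \<sigma> permutes {0..<d}. T \<sigma> r) = (\<Sum>\<sigma> | \<sigma> permutes {0..<d}. - T \<sigma> r)"
      by (subst sum_permutations_compose_right[OF tr]) (intro sum.cong refl; simp)
    then show ?thesis by (simp add: sum_negf)
  qed
  have "(\<Sum>j<d. partial_deriv j (metric_poly d P i j) \<eta>) =
    (\<Sum>j<d. \<Sum>\<sigma> | \<sigma> permutes {0..<d} \<and> \<sigma> i = j. \<Sum>r\<in>{0..<d} - {i}. T \<sigma> r)"
    by (rule sum.cong[OF refl])
       (use has_partial_metric_poly[OF \<eta> i] in \<open>simp add: partial_deriv_eqI T_def sum_distrib_left\<close>)
  also have "\<dots> = (\<Sum>\<sigma> | \<sigma> permutes {0..<d}. \<Sum>r\<in>{0..<d} - {i}. T \<sigma> r)"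
    by (rule sum_perms_by_image[OF i])
  also have "\<dots> = (\<Sum>r\<in>{0..<d} - {i}. \<Sum>\<sigma> | \<sigma> permutes {0..<d}. T \<sigma> r)"
    by (rule sum.swap)
  also have "\<dots> = 0"
    by (rule sum.neutral) (use cancel in blast)
  finally show ?thesis .
qed

section \<open>Pullback of polynomials and the chain rule\<close>

text \<open>The map is affine along coordinate lines, so total degree \<open>k\<close> bounds the degree in each
  coordinate of the cube.\<close>

lemma coord_poly_pullback:
  assumes "f \<in> poly_space d k"
  shows "coord_poly d k (\<lambda>\<eta>. f (sub_map d P \<eta>))"
proof -
  obtain c where c: "\<And>\<xi>. \<xi> \<in> carrier_vec d \<Longrightarrow> f \<xi> = (\<Sum>a | a \<in> {..<d} \<rightarrow>\<^sub>E {..k} \<and> (\<Sum>j<d. a j) \<le> k.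
      c a * (\<Prod>j<d. (\<xi> $ j) ^ a j))"
    using assms unfolding poly_space_def by blast
  have "coord_poly d k (\<lambda>\<eta>. c a * (\<Prod>j<d. map_deriv d P {} j \<eta> ^ a j))" if "(\<Sum>j<d. a j) \<le> k" for a
  proof -
    have "coord_poly d (0 + (\<Sum>j<d. a j * 1)) (\<lambda>\<eta>. c a * (\<Prod>j<d. map_deriv d P {} j \<eta> ^ a j))"
      by (intro coord_poly_mult coord_poly_const coord_poly_prod coord_poly_power coord_poly_map_deriv)
    then show ?thesis by (rule coord_poly_mono) (use that in simp)
  qed
  then have "coord_poly d k (\<lambda>\<eta>. \<Sum>a | a \<in> {..<d} \<rightarrow>\<^sub>E {..k} \<and> (\<Sum>j<d. a j) \<le> k.
      c a * (\<Prod>j<d. map_deriv d P {} j \<eta> ^ a j))"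
    by (intro coord_poly_sum) simp
  then show ?thesis
    by (rule coord_poly_cong) (simp add: c sub_map_index)
qed

lemma poly_space_chain_rule:
  fixes u :: "real \<Rightarrow> real vec"
  assumes f: "f \<in> poly_space d k" and u: "\<And>t. u t \<in> carrier_vec d"
    and du: "\<And>r. r < d \<Longrightarrow> ((\<lambda>t. u t $ r) has_real_derivative u' r) (at t0)"
  shows "((\<lambda>t. f (u t)) has_real_derivative (\<Sum>r<d. u' r * partial_deriv r f (u t0))) (at t0)"
proof -
  let ?A = "{a. a \<in> {..<d} \<rightarrow>\<^sub>E {..k} \<and> (\<Sum>j<d. a j) \<le> k}"
  obtain c where c: "\<And>\<xi>. \<xi> \<in> carrier_vec d \<Longrightarrow> f \<xi> = (\<Sum>a\<in>?A. c a * (\<Prod>j<d. (\<xi> $ j) ^ a j))"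
    using f unfolding poly_space_def by blast
  \<comment> \<open>The formal partial derivative.  For \<open>a r = 0\<close> the truncated exponent is \<open>0\<close> instead of
    \<open>-1\<close>, but there the factor \<open>a r\<close> vanishes.\<close>
  define G where "G r \<xi> = (\<Sum>a\<in>?A. c a * (real (a r) * (\<xi> $ r) ^ (a r - 1) *
     (\<Prod>s\<in>{..<d} - {r}. (\<xi> $ s) ^ a s)))" for r and \<xi> :: "real vec"
  have D: "((\<lambda>t. f (u t)) has_real_derivative (\<Sum>r<d. u' r * G r (u t0))) (at t0)"
    if u: "\<And>t. u t \<in> carrier_vec d"
      and du: "\<And>r. r < d \<Longrightarrow> ((\<lambda>t. u t $ r) has_real_derivative u' r) (at t0)"
    for u :: "real \<Rightarrow> real vec" and u' t0
  proof -
    have "((\<lambda>t. \<Sum>a\<in>?A. c a * (\<Prod>j<d. (u t $ j) ^ a j)) has_real_derivative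
      (\<Sum>a\<in>?A. c a * (\<Sum>r<d. (real (a r) * (u' r * (u t0 $ r) ^ (a r - Suc 0))) *
        (\<Prod>s\<in>{..<d} - {r}. (u t0 $ s) ^ a s)))) (at t0)"
      by (intro DERIV_sum DERIV_cmult has_field_derivative_prod DERIV_power du) simp
    also have "(\<Sum>a\<in>?A. c a * (\<Sum>r<d. (real (a r) * (u' r * (u t0 $ r) ^ (a r - Suc 0))) *
        (\<Prod>s\<in>{..<d} - {r}. (u t0 $ s) ^ a s))) = (\<Sum>r<d. u' r * G r (u t0))"
      unfolding G_def sum_distrib_left
      by (subst sum.swap) (intro sum.cong refl, simp add: mult_ac)
    finally show ?thesis using c[OF u] by (simp only:)
  qed
  \<comment> \<open>Coordinate lines are curves too, which identifies \<open>G\<close> with the partial derivatives.\<close>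
  have "partial_deriv r f \<xi> = G r \<xi>" if \<xi>: "\<xi> \<in> carrier_vec d" and r: "r < d" for r \<xi>
  proof -
    have "has_partial f (\<Sum>s<d. of_bool (s = r) * G s (\<xi> |\<^sub>v r \<mapsto> (\<xi> $ r))) r \<xi>"
    proof (rule D)
      show "(\<xi> |\<^sub>v r \<mapsto> t) \<in> carrier_vec d" for t using \<xi> by simp
      show "((\<lambda>t. (\<xi> |\<^sub>v r \<mapsto> t) $ s) has_real_derivative of_bool (s = r)) (at (\<xi> $ r))" if "s < d" for s
        using \<xi> that by (cases "s = r") (simp_all add: update_vec_index)
    qed
    moreover have "(\<Sum>s<d. of_bool (s = r) * G s \<xi>) = G r \<xi>"
      using r by (simp add: of_bool_def if_distrib[of "\<lambda>z. z * _"] cong: if_cong)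
    ultimately show ?thesis
      by (simp only: update_vec_same partial_deriv_eqI)
  qed
  then have "(\<Sum>r<d. u' r * partial_deriv r f (u t0)) = (\<Sum>r<d. u' r * G r (u t0))"
    using u by (intro sum.cong) auto
  then show ?thesis using D[OF u du] by (simp only:)
qed

lemma partial_deriv_pullback:
  assumes f: "f \<in> poly_space d k" and \<eta>: "\<eta> \<in> carrier_vec d" and j: "j < d"
  shows "partial_deriv j (\<lambda>\<eta>. f (sub_map d P \<eta>)) \<eta> =
    (\<Sum>r<d. map_deriv d P {j} r \<eta> * partial_deriv r f (sub_map d P \<eta>))"
proof -
  have "has_partial (\<lambda>\<eta>. f (sub_map d P \<eta>))
    (\<Sum>r<d. map_deriv d P {j} r \<eta> * partial_deriv r f (sub_map d P (\<eta> |\<^sub>v j \<mapsto> (\<eta> $ j)))) j \<eta>"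
  proof (rule poly_space_chain_rule[OF f])
    fix r assume "r < d"
    then show "has_partial (\<lambda>\<zeta>. sub_map d P \<zeta> $ r) (map_deriv d P {j} r \<eta>) j \<eta>"
      using has_partial_map_deriv[OF \<eta> j, of "{}" P r] by (simp add: sub_map_index)
  qed simp
  then show ?thesis by (simp only: update_vec_same partial_deriv_eqI)
qed

section \<open>Nodes and restriction matrices of the facets\<close>

text \<open>The position of coordinate \<open>k\<close> among the coordinates other than \<open>f\<close>.\<close>

definition drop_coord :: "nat \<Rightarrow> nat \<Rightarrow> nat" where
  "drop_coord f k = (if k < f then k else k - 1)"

lemma bij_betw_drop_coord:
  assumes "f < d"
  shows "bij_betw (drop_coord f) ({..<d} - {f}) {..<d - 1}"
  by (rule bij_betw_byWitness[where f' = "\<lambda>k. if k < f then k else Suc k"])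
     (use assms in \<open>auto simp: drop_coord_def split: if_splits\<close>)

definition end_index :: "nat \<Rightarrow> real \<Rightarrow> nat" where
  "end_index n s = (if s = -1 then 0 else n - 1)"

text \<open>The \<open>\<mu>\<close>-th node of the facet \<open>\<gamma>\<close> is the \<open>m\<close>-th node of the cube.\<close>

definition facet_point :: "nat \<Rightarrow> nat \<Rightarrow> nat \<times> real \<Rightarrow> nat \<Rightarrow> nat \<Rightarrow> bool" where
  "facet_point d n \<gamma> \<mu> m \<longleftrightarrow> digit n m (fst \<gamma>) = end_index n (snd \<gamma>) \<and>
     (\<forall>k\<in>{..<d} - {fst \<gamma>}. digit n \<mu> (drop_coord (fst \<gamma>) k) = digit n m k)"

lemma facet_point_unique:
  assumes "fst \<gamma> < d" "facet_point d n \<gamma> \<mu> m" "facet_point d n \<gamma> \<mu>' m" "\<mu> < n ^ (d - 1)" "\<mu>' < n ^ (d - 1)"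
  shows "\<mu> = \<mu>'"
proof (rule digits_eqI[OF assms(4,5)])
  fix k assume "k < d - 1"
  then have "k \<in> drop_coord (fst \<gamma>) ` ({..<d} - {fst \<gamma>})"
    using bij_betw_imp_surj_on[OF bij_betw_drop_coord[OF assms(1)]] by simp
  then obtain k' where "k' \<in> {..<d} - {fst \<gamma>}" "k = drop_coord (fst \<gamma>) k'" by blast
  then show "digit n \<mu> k = digit n \<mu>' k"
    using assms(2,3) by (simp add: facet_point_def)
qed

lemma facet_point_inj:
  assumes "facet_point d n \<gamma> \<mu> m" "facet_point d n \<gamma> \<mu> m'" "m < n ^ d" "m' < n ^ d"
  shows "m = m'"
proof (rule digits_eqI[OF assms(3,4)])
  fix k assume "k < d"
  then show "digit n m k = digit n m' k"
    using assms(1,2) unfolding facet_point_def by (cases "k = fst \<gamma>") auto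
qed

lemma facet_point_exists:
  assumes f: "fst \<gamma> < d" and m: "m < n ^ d" and e: "digit n m (fst \<gamma>) = end_index n (snd \<gamma>)"
  shows "\<exists>\<mu> < n ^ (d - 1). facet_point d n \<gamma> \<mu> m"
proof -
  have n: "0 < n" by (rule base_pos[OF m f])
  let ?g = "the_inv_into ({..<d} - {fst \<gamma>}) (drop_coord (fst \<gamma>))"
  obtain \<mu> where \<mu>: "\<mu> < n ^ (d - 1)" "\<And>k. k < d - 1 \<Longrightarrow> digit n \<mu> k = digit n m (?g k)"
    using digits_exist[of "d - 1" "\<lambda>k. digit n m (?g k)" n] digit_less[OF n] by blast
  have "digit n \<mu> (drop_coord (fst \<gamma>) k) = digit n m k" if k: "k \<in> {..<d} - {fst \<gamma>}" for k
  proof -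
    have "drop_coord (fst \<gamma>) k < d - 1"
      using bij_betwE[OF bij_betw_drop_coord[OF f]] k by blast
    moreover have "?g (drop_coord (fst \<gamma>) k) = k"
      by (rule the_inv_into_f_f[OF bij_betw_imp_inj_on[OF bij_betw_drop_coord[OF f]] k])
    ultimately show ?thesis using \<mu>(2) by simp
  qed
  then show ?thesis using \<mu>(1) e by (auto simp: facet_point_def)
qed

lemma dim_end_row: "dim_row (end_row n s) = 1" "dim_col (end_row n s) = n"
  by (simp_all add: end_row_def mat_of_row_def)

lemma end_row_index: "b < n \<Longrightarrow> end_row n s $$ (0, b) = of_bool (b = end_index n s)"
  by (auto simp: end_row_def mat_of_row_def unit_vec_def end_index_def)

lemma facet_R_entries:
  assumes f: "fst \<gamma> < d" and n: "0 < n"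
  shows "facet_R d n \<gamma> \<in> carrier_mat (n ^ (d - 1)) (n ^ d)"
    and "\<lbrakk>\<mu> < n ^ (d - 1); m < n ^ d\<rbrakk> \<Longrightarrow> facet_R d n \<gamma> $$ (\<mu>, m) = of_bool (facet_point d n \<gamma> \<mu> m)"
proof -
  define F where "F k = (if k = fst \<gamma> then end_row n (snd \<gamma>) else 1\<^sub>m n)" for k
  have R: "facet_R d n \<gamma> = kron_prod F d"
    by (simp add: facet_R_def F_def[abs_def])
  have row: "dim_row (F k) = (if k = fst \<gamma> then 1 else n)" and col: "dim_col (F k) = n" for k
    by (simp_all add: F_def dim_end_row)
  have rows: "(\<Prod>l<k. dim_row (F l)) = n ^ (if k \<le> fst \<gamma> then k else k - 1)" for k
    unfolding row by (induction k) (auto simp: power_eq_if)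
  have cols: "(\<Prod>l<k. dim_col (F l)) = n ^ k" for k
    by (simp only: col prod_constant card_lessThan)
  have dims: "dim_row (kron_prod F d) = n ^ (d - 1)" "dim_col (kron_prod F d) = n ^ d"
    using f by (simp_all only: dim_kron_prod rows cols) simp
  show "facet_R d n \<gamma> \<in> carrier_mat (n ^ (d - 1)) (n ^ d)"
    unfolding R by (rule carrier_matI) (rule dims)+
  assume \<mu>: "\<mu> < n ^ (d - 1)" and m: "m < n ^ d"
  have "facet_R d n \<gamma> $$ (\<mu>, m) = (\<Prod>k<d. F k $$
    (\<mu> div (\<Prod>l<k. dim_row (F l)) mod dim_row (F k), m div (\<Prod>l<k. dim_col (F l)) mod dim_col (F k)))"
    unfolding R
    by (rule kron_prod_index) (use \<mu> m dims in \<open>simp_all only: dim_kron_prod[symmetric]\<close>)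
  also have "\<dots> = (\<Prod>k<d. of_bool (if k = fst \<gamma> then digit n m k = end_index n (snd \<gamma>)
     else digit n \<mu> (drop_coord (fst \<gamma>) k) = digit n m k))"
  proof (rule prod.cong[OF refl])
    fix k
    have "F k $$ (\<mu> div (\<Prod>l<k. dim_row (F l)) mod dim_row (F k), m div (\<Prod>l<k. dim_col (F l)) mod dim_col (F k))
      = F k $$ (if k = fst \<gamma> then 0 else digit n \<mu> (drop_coord (fst \<gamma>) k), digit n m k)"
      unfolding rows cols col unfolding row digit_def drop_coord_def
      by (cases "k = fst \<gamma>") (auto simp: not_less)
    also have "\<dots> = of_bool (if k = fst \<gamma> then digit n m k = end_index n (snd \<gamma>)
     else digit n \<mu> (drop_coord (fst \<gamma>) k) = digit n m k)"
      using digit_less[OF n] by (simp add: F_def end_row_index)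
    finally show "F k $$ (\<mu> div (\<Prod>l<k. dim_row (F l)) mod dim_row (F k), m div (\<Prod>l<k. dim_col (F l)) mod dim_col (F k))
      = of_bool (if k = fst \<gamma> then digit n m k = end_index n (snd \<gamma>)
     else digit n \<mu> (drop_coord (fst \<gamma>) k) = digit n m k)" .
  qed
  also have "\<dots> = of_bool (\<forall>k\<in>{..<d}. if k = fst \<gamma> then digit n m k = end_index n (snd \<gamma>)
     else digit n \<mu> (drop_coord (fst \<gamma>) k) = digit n m k)"
  proof (cases "\<forall>k\<in>{..<d}. if k = fst \<gamma> then digit n m k = end_index n (snd \<gamma>)
     else digit n \<mu> (drop_coord (fst \<gamma>) k) = digit n m k")
    case True
    then have "(\<Prod>k<d. of_bool (if k = fst \<gamma> then digit n m k = end_index n (snd \<gamma>)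
       else digit n \<mu> (drop_coord (fst \<gamma>) k) = digit n m k)) = (1 :: real)"
      by (intro prod.neutral) auto
    then show ?thesis using True by simp
  next
    case False
    then show ?thesis by (simp only: of_bool_eq prod_zero_iff finite_lessThan) auto
  qed
  also have "(\<forall>k\<in>{..<d}. if k = fst \<gamma> then digit n m k = end_index n (snd \<gamma>)
     else digit n \<mu> (drop_coord (fst \<gamma>) k) = digit n m k) = facet_point d n \<gamma> \<mu> m"
    using f by (auto simp: facet_point_def)
  finally show "facet_R d n \<gamma> $$ (\<mu>, m) = of_bool (facet_point d n \<gamma> \<mu> m)" .
qed

lemma facet_node_eq:
  assumes "facet_point d n \<gamma> \<mu> m" "fst \<gamma> < d" "x $ end_index n (snd \<gamma>) = snd \<gamma>"
  shows "facet_node d n x \<gamma> \<mu> = cube_node d n x m"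
proof (rule eq_vecI)
  fix k assume "k < dim_vec (cube_node d n x m)"
  then have k: "k < d" by (simp add: cube_node_def)
  show "facet_node d n x \<gamma> \<mu> $ k = cube_node d n x m $ k"
  proof (cases "k = fst \<gamma>")
    case True
    then show ?thesis using assms k by (simp add: facet_node_def cube_node_index facet_point_def)
  next
    case False
    then have "digit n \<mu> (drop_coord (fst \<gamma>) k) = digit n m k"
      using assms(1) k by (simp add: facet_point_def)
    then show ?thesis using k False
      by (auto simp: facet_node_def cube_node_index drop_coord_def digit_def split: if_splits)
  qed
qed (simp add: facet_node_def cube_node_def)

section \<open>Split form of the subdomain operator\<close>

text \<open>\<open>R\<^sub>\<gamma>\<^sup>T B\<^sub>\<gamma> N\<^sub>\<gamma> R\<^sub>\<gamma>\<close> is diagonal and supported on the nodes of \<open>\<gamma>\<close>.  The sign \<open>s\<close> comes from the outward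
  normal, which selects the single metric term \<open>j = f\<close>.\<close>

lemma facet_contribution:
  assumes H: "H \<in> carrier_mat n n" "diagonal_mat H"
    and f: "f < d" and s: "x $ end_index n s = s" and m: "m < n ^ d" "m' < n ^ d"
  shows "(transpose_mat (facet_R d n (f, s)) * facet_B d H * sub_N d n x P i (f, s) * facet_R d n (f, s)) $$ (m, m') =
    (if m = m' \<and> digit n m f = end_index n s
     then s * metric_term d P i f (cube_node d n x m) * (\<Prod>k\<in>{..<d} - {f}. H $$ (digit n m k, digit n m k))
     else 0)" (is "?lhs = ?rhs")
proof -
  have n: "0 < n" by (rule base_pos[OF m(1) f])
  have f': "fst (f, s) < d" using f by simp
  have B: "facet_B d H = tp_H (d - 1) H" by (simp add: facet_B_def tp_H_def)
  define N where "N = n ^ (d - 1)"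
  define w where "w \<mu> = (\<Sum>j<d. facet_normal (f, s) j * metric_term d P i j (facet_node d n x (f, s) \<mu>))" for \<mu>
  have lhs: "?lhs = (\<Sum>\<mu><N. of_bool (facet_point d n (f, s) \<mu> m) * tp_H (d - 1) H $$ (\<mu>, \<mu>) * w \<mu> *
      of_bool (facet_point d n (f, s) \<mu> m'))"
    unfolding B sub_N_def w_def[symmetric] N_def
    by (subst diagonal_congruence_index[OF facet_R_entries(1)[OF f' n] tp_H_carrier[OF H(1)] tp_H_diagonal[OF H] m])
       (intro sum.cong refl, simp add: facet_R_entries(2)[OF f' n] m)
  show ?thesis
  proof (cases "m = m' \<and> digit n m f = end_index n s")
    case False
    have "\<not> (facet_point d n (f, s) \<mu> m \<and> facet_point d n (f, s) \<mu> m')" for \<mu>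
    proof
      assume "facet_point d n (f, s) \<mu> m \<and> facet_point d n (f, s) \<mu> m'"
      moreover from this have "m = m'" using facet_point_inj m by blast
      ultimately show False using False by (simp add: facet_point_def)
    qed
    then have "?lhs = 0" unfolding lhs by (intro sum.neutral) auto
    then show ?thesis using False by auto
  next
    case True
    then obtain \<mu> where \<mu>: "\<mu> < N" "facet_point d n (f, s) \<mu> m"
      using facet_point_exists[OF f' m(1)] by (auto simp: N_def)
    have unique: "\<nu> = \<mu>" if "\<nu> < N" "facet_point d n (f, s) \<nu> m" for \<nu>
      using facet_point_unique[OF f' that(2) \<mu>(2)] that(1) \<mu>(1) by (simp add: N_def)
    have "?lhs = (\<Sum>\<nu>\<in>{\<mu>}. of_bool (facet_point d n (f, s) \<nu> m) * tp_H (d - 1) H $$ (\<nu>, \<nu>) * w \<nu> *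
      of_bool (facet_point d n (f, s) \<nu> m'))"
      unfolding lhs
      by (rule sum.mono_neutral_right)
         (use \<mu>(1) unique in auto)
    also have "\<dots> = tp_H (d - 1) H $$ (\<mu>, \<mu>) * w \<mu>"
      using \<mu> True by simp
    also have "w \<mu> = s * metric_term d P i f (cube_node d n x m)"
    proof -
      have "w \<mu> = (\<Sum>j<d. if j = f then s * metric_term d P i j (cube_node d n x m) else 0)"
        unfolding w_def facet_normal_def using facet_node_eq[OF \<mu>(2) f'] s
        by (intro sum.cong) auto
      then show ?thesis using f by simp
    qed
    also have "tp_H (d - 1) H $$ (\<mu>, \<mu>) = (\<Prod>k<d - 1. H $$ (digit n \<mu> k, digit n \<mu> k))"
      by (rule tp_H_index[OF H(1)]) (use \<mu> in \<open>simp_all add: N_def\<close>)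
    also have "\<dots> = (\<Prod>k\<in>{..<d} - {f}. H $$ (digit n \<mu> (drop_coord f k), digit n \<mu> (drop_coord f k)))"
      by (rule prod.reindex_bij_betw[OF bij_betw_drop_coord[OF f], symmetric])
    also have "\<dots> = (\<Prod>k\<in>{..<d} - {f}. H $$ (digit n m k, digit n m k))"
      by (rule prod.cong) (use \<mu>(2) in \<open>auto simp: facet_point_def\<close>)
    finally show ?thesis unfolding if_P[OF True] by (simp only: mult_ac)
  qed
qed

text \<open>The two facets orthogonal to the \<open>\<eta>\<^sub>j\<close> axis contribute the two end points in
  \<open>Q + Q\<^sup>T\<close>, and the facet quadrature supplies the weights of the other coordinates.\<close>

lemma sub_E_index:
  fixes x :: "real vec"
  assumes H: "H \<in> carrier_mat n n" "diagonal_mat H" and Q: "Q \<in> carrier_mat n n"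
    and QE: "\<And>a b. \<lbrakk>a < n; b < n\<rbrakk> \<Longrightarrow> Q $$ (a, b) + Q $$ (b, a) =
      (if a = b then of_bool (a = n - 1) - of_bool (a = 0) else 0)"
    and x: "x $ 0 = -1" "x $ (n - 1) = 1" and m: "m < n ^ d" "m' < n ^ d"
  shows "sub_E d n x H P i $$ (m, m') = (\<Sum>j<d. metric_term d P i j (cube_node d n x m) *
    (tp_Q d H Q j $$ (m, m') + tp_Q d H Q j $$ (m', m)))"
proof -
  let ?G = "\<lambda>\<gamma>. (transpose_mat (facet_R d n \<gamma>) * facet_B d H * sub_N d n x P i \<gamma> * facet_R d n \<gamma>) $$ (m, m')"
  have "sub_E d n x H P i $$ (m, m') = (\<Sum>\<gamma>\<in>facet_indices d. ?G \<gamma>)"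
    unfolding sub_E_def mat_sum_def using m by simp
  also have "\<dots> = (\<Sum>j<d. \<Sum>s\<in>{-1, 1}. ?G (j, s))"
    unfolding facet_indices_def sum.cartesian_product split_def by (simp only: prod.collapse)
  also have "\<dots> = (\<Sum>j<d. metric_term d P i j (cube_node d n x m) *
    (tp_Q d H Q j $$ (m, m') + tp_Q d H Q j $$ (m', m)))"
  proof (rule sum.cong[OF refl])
    fix j assume "j \<in> {..<d}"
    then have j: "j < d" by simp
    have "(\<Sum>s\<in>{-1, 1}. ?G (j, s)) = ?G (j, -1) + ?G (j, 1)" by simp
    also have "\<dots> = metric_term d P i j (cube_node d n x m) *
       (if m = m' then (of_bool (digit n m j = n - 1) - of_bool (digit n m j = 0)) *
         (\<Prod>k\<in>{..<d} - {j}. H $$ (digit n m k, digit n m k)) else 0)"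
      using x by (subst (1 2) facet_contribution[OF H j _ m]) (auto simp: end_index_def algebra_simps)
    finally show "(\<Sum>s\<in>{-1, 1}. ?G (j, s)) = metric_term d P i j (cube_node d n x m) *
      (tp_Q d H Q j $$ (m, m') + tp_Q d H Q j $$ (m', m))"
      by (simp only: tp_Q_symmetric_part[OF H Q j m QE])
  qed
  finally show ?thesis .
qed

text \<open>The boundary term \<open>E\<close> is diagonal, so its metric factor may be evaluated at either of the two nodes.
  Evaluated at \<open>m'\<close>, it cancels the transposed half of the skew-symmetric part.\<close>

lemma sub_Q_index:
  fixes x :: "real vec"
  assumes H: "H \<in> carrier_mat n n" "diagonal_mat H" and Q: "Q \<in> carrier_mat n n"
    and QE: "\<And>a b. \<lbrakk>a < n; b < n\<rbrakk> \<Longrightarrow> Q $$ (a, b) + Q $$ (b, a) =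
      (if a = b then of_bool (a = n - 1) - of_bool (a = 0) else 0)"
    and x: "x $ 0 = -1" "x $ (n - 1) = 1" and m: "m < n ^ d" "m' < n ^ d"
  shows "sub_Q d n x H Q P i $$ (m, m') = (\<Sum>j<d.
    (metric_term d P i j (cube_node d n x m) + metric_term d P i j (cube_node d n x m')) *
    tp_Q d H Q j $$ (m, m')) / 2"
proof -
  define a where "a j k = metric_term d P i j (cube_node d n x k)" for j k
  define q where "q j k l = tp_Q d H Q j $$ (k, l)" for j k l
  have eq: "a j m * (q j m m' + q j m' m) = a j m' * (q j m m' + q j m' m)" if "j < d" for j
    unfolding q_def using tp_Q_symmetric_part[OF H Q that m QE] by (cases "m = m'") simp_all
  have "sub_E d n x H P i $$ (m, m') = (\<Sum>j<d. a j m * (q j m m' + q j m' m))"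
    unfolding a_def q_def by (rule sub_E_index[OF H Q _ x m]) (rule QE)
  also have "\<dots> = (\<Sum>j<d. a j m' * (q j m m' + q j m' m))"
    by (rule sum.cong[OF refl]) (simp only: eq lessThan_iff)
  finally have E: "sub_E d n x H P i $$ (m, m') = \<dots>" .
  have S: "sub_S d n x H Q P i $$ (m, m') = (\<Sum>j<d. a j m * q j m m' - a j m' * q j m' m) / 2"
    unfolding sub_S_def a_def q_def using m by simp
  have "dim_row (sub_E d n x H P i) = n ^ d" "dim_col (sub_E d n x H P i) = n ^ d"
    by (simp_all add: sub_E_def mat_sum_def)
  then have "sub_Q d n x H Q P i $$ (m, m') =
    (\<Sum>j<d. a j m * q j m m' - a j m' * q j m' m) / 2 + (\<Sum>j<d. a j m' * (q j m m' + q j m' m)) / 2"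
    unfolding sub_Q_def using m by (simp add: S E)
  also have "\<dots> = (\<Sum>j<d. (a j m + a j m') * q j m m') / 2"
    unfolding add_divide_distrib[symmetric] sum.distrib[symmetric]
    by (intro arg_cong2[where f = "(/)"] sum.cong refl) (simp add: algebra_simps)
  finally show ?thesis unfolding a_def q_def .
qed

section \<open>Exactness on a subdomain\<close>

lemma sbp_1d_entrywise:
  fixes x :: "real vec" and H Q :: "real mat"
  assumes "sbp_1d p n x H Q"
  shows "H \<in> carrier_mat n n" "diagonal_mat H" "\<And>a. a < n \<Longrightarrow> 0 < H $$ (a, a)"
    "Q \<in> carrier_mat n n" "x $ 0 = -1" "x $ (n - 1) = (1 :: real)"
    "\<And>a b. \<lbrakk>a < n; b < n\<rbrakk> \<Longrightarrow> Q $$ (a, b) + Q $$ (b, a) =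
      (if a = b then of_bool (a = n - 1) - of_bool (a = 0) else 0)"
    "\<And>q a. \<lbrakk>degree q \<le> p; a < n\<rbrakk> \<Longrightarrow>
      (\<Sum>r<n. Q $$ (a, r) * poly q (x $ r)) = H $$ (a, a) * poly (pderiv q) (x $ a)"
proof -
  show H: "H \<in> carrier_mat n n" "diagonal_mat H" and pos: "\<And>a. a < n \<Longrightarrow> 0 < H $$ (a, a)"
    and Q: "Q \<in> carrier_mat n n" and "x $ 0 = -1" "x $ (n - 1) = (1 :: real)"
    using assms by (simp_all add: sbp_1d_def)
  show "Q $$ (a, b) + Q $$ (b, a) = (if a = b then of_bool (a = n - 1) - of_bool (a = 0) else 0)"
    if ab: "a < n" "b < n" for a b
  proof -
    have end_mat: "(transpose_mat (end_row n s) * end_row n s) $$ (a, b) =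
       of_bool (a = end_index n s) * of_bool (b = end_index n s)" for s
      using ab by (simp add: scalar_prod_def dim_end_row end_row_index)
    have "Q $$ (a, b) + Q $$ (b, a) = (Q + transpose_mat Q) $$ (a, b)"
      using Q ab by simp
    also have "Q + transpose_mat Q =
       transpose_mat (end_row n 1) * end_row n 1 - transpose_mat (end_row n (-1)) * end_row n (-1)"
      using assms by (simp add: sbp_1d_def)
    also have "\<dots> $$ (a, b) = (transpose_mat (end_row n 1) * end_row n 1) $$ (a, b)
      - (transpose_mat (end_row n (-1)) * end_row n (-1)) $$ (a, b)"
      using ab by (simp add: dim_end_row del: index_mult_mat(1))
    finally show ?thesis
      unfolding end_mat by (auto simp: end_index_def)
  qed
  show "(\<Sum>r<n. Q $$ (a, r) * poly q (x $ r)) = H $$ (a, a) * poly (pderiv q) (x $ a)"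
    if "degree q \<le> p" "a < n" for q a
  proof -
    have nz: "H $$ (a, a) \<noteq> 0" if "a < n" for a using pos[OF that] by simp
    have "(mat_inv H * Q) *\<^sub>v vec n (\<lambda>i. poly q (x $ i)) = vec n (\<lambda>i. poly (pderiv q) (x $ i))"
      using assms that by (simp add: sbp_1d_def)
    moreover have "(mat_inv H * Q) *\<^sub>v vec n u = vec n w \<longleftrightarrow>
      (\<forall>a<n. (\<Sum>r<n. Q $$ (a, r) * u r) = H $$ (a, a) * w a)" for u w
      by (rule diagonal_inv_mult_vec_iff[OF H _ Q]) (rule nz)
    ultimately show ?thesis using that(2) by simp
  qed
qed

text \<open>On the grid line through node \<open>m\<close> this is the exactness of the one-dimensional operator; the weights of
  the other coordinates complete the one-dimensional weight to the entry of the mass matrix.\<close>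

lemma tp_Q_exact:
  assumes sbp: "sbp_1d p n x H Q" and g: "coord_poly d p g" and j: "j < d" and m: "m < n ^ d"
  shows "(\<Sum>m'<n ^ d. tp_Q d H Q j $$ (m, m') * g (cube_node d n x m')) =
    tp_H d H $$ (m, m) * partial_deriv j g (cube_node d n x m)"
proof -
  note sbp' = sbp_1d_entrywise[OF sbp]
  have a: "digit n m j < n" by (rule digit_less[OF base_pos[OF m j]])
  obtain q where q: "degree q \<le> p" "\<And>t. g (cube_node d n x m |\<^sub>v j \<mapsto> t) = poly q t"
    using coord_polyE[OF g cube_node_carrier j] by blast
  have D: "partial_deriv j g (cube_node d n x m) = poly (pderiv q) (x $ digit n m j)"
    using poly_DERIV[of q "cube_node d n x m $ j"] cube_node_index[OF j, of n x m]
    by (intro partial_deriv_eqI) (simp add: q(2))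
  have "tp_H d H $$ (m, m) = (\<Prod>k<d. H $$ (digit n m k, digit n m k))"
    by (rule tp_H_index[OF sbp'(1) m m])
  also have "\<dots> = H $$ (digit n m j, digit n m j) * (\<Prod>k\<in>{..<d} - {j}. H $$ (digit n m k, digit n m k))"
    by (rule prod.remove) (use j in auto)
  finally have W: "tp_H d H $$ (m, m) = \<dots>" .
  show ?thesis
    unfolding tp_Q_apply[OF sbp'(1,2,4) j m] q(2) sbp'(8)[OF q(1) a] W D by (simp only: mult_ac)
qed

lemma sub_Q_exact:
  assumes sbp: "sbp_1d p n x H Q" and i: "i < d" and f: "f \<in> poly_space d k" and k: "k + (d - 1) \<le> p"
    and jac: "\<And>m. m < n ^ d \<Longrightarrow> jac_det d P (cube_node d n x m) \<noteq> 0" and m: "m < n ^ d"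
  shows "(\<Sum>m'<n ^ d. sub_Q d n x H Q P i $$ (m, m') * f (sub_map d P (cube_node d n x m'))) =
    sub_H d n x H P $$ (m, m) * partial_deriv i f (sub_map d P (cube_node d n x m))"
proof -
  note sbp' = sbp_1d_entrywise[OF sbp]
  define F where "F \<eta> = f (sub_map d P \<eta>)" for \<eta>
  define \<eta> where "\<eta> = cube_node d n x m"
  have \<eta>: "\<eta> \<in> carrier_vec d" by (simp add: \<eta>_def)
  let ?A = "metric_poly d P i" and ?W = "tp_H d H $$ (m, m)" and ?q = "\<lambda>j m'. tp_Q d H Q j $$ (m, m')"
    and ?y = "cube_node d n x"
  have F: "coord_poly d k F"
    unfolding F_def by (rule coord_poly_pullback[OF f])
  have A: "coord_poly d (d - 1) (?A j)" for j by (rule coord_poly_metric[OF i])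
  have F': "coord_poly d p F" by (rule coord_poly_mono[OF F]) (use k in simp)
  have AF: "coord_poly d p (\<lambda>\<zeta>. ?A j \<zeta> * F \<zeta>)" for j
    by (rule coord_poly_mono[OF coord_poly_mult[OF A F]]) (use k in simp)
  have "(\<Sum>m'<n ^ d. sub_Q d n x H Q P i $$ (m, m') * F (?y m')) =
    (\<Sum>m'<n ^ d. \<Sum>j<d. (?A j \<eta> * (?q j m' * F (?y m')) + ?q j m' * (?A j (?y m') * F (?y m'))) / 2)"
  proof (rule sum.cong[OF refl])
    fix m' assume "m' \<in> {..<n ^ d}"
    then have m': "m' < n ^ d" by simp
    have "sub_Q d n x H Q P i $$ (m, m') = (\<Sum>j<d.
      (metric_term d P i j (?y m) + metric_term d P i j (?y m')) * ?q j m') / 2"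
      by (rule sub_Q_index[OF sbp'(1,2,4) _ sbp'(5,6) m m']) (rule sbp'(7))
    also have "\<dots> = (\<Sum>j<d. (?A j \<eta> + ?A j (?y m')) * ?q j m') / 2"
      using i jac[OF m] jac[OF m'] by (simp add: metric_term_eq \<eta>_def)
    finally have "sub_Q d n x H Q P i $$ (m, m') * F (?y m') =
      (\<Sum>j<d. (?A j \<eta> + ?A j (?y m')) * ?q j m') / 2 * F (?y m')" by (simp only:)
    also have "\<dots> = (\<Sum>j<d. (?A j \<eta> * (?q j m' * F (?y m')) + ?q j m' * (?A j (?y m') * F (?y m'))) / 2)"
      unfolding sum_divide_distrib sum_distrib_right
      by (rule sum.cong[OF refl]) (simp add: field_simps)
    finally show "sub_Q d n x H Q P i $$ (m, m') * F (?y m') =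
      (\<Sum>j<d. (?A j \<eta> * (?q j m' * F (?y m')) + ?q j m' * (?A j (?y m') * F (?y m'))) / 2)" .
  qed
  also have "\<dots> = (\<Sum>j<d. (?A j \<eta> * (\<Sum>m'<n ^ d. ?q j m' * F (?y m')) +
      (\<Sum>m'<n ^ d. ?q j m' * (?A j (?y m') * F (?y m')))) / 2)"
    by (subst sum.swap)
       (simp only: sum_divide_distrib[symmetric] sum.distrib sum_distrib_left[symmetric])
  also have "\<dots> = (\<Sum>j<d. ?W * (?A j \<eta> * partial_deriv j F \<eta> + F \<eta> / 2 * partial_deriv j (?A j) \<eta>))"
  proof (rule sum.cong[OF refl])
    fix j assume "j \<in> {..<d}"
    then have j: "j < d" by simp
    show "(?A j \<eta> * (\<Sum>m'<n ^ d. ?q j m' * F (?y m')) +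
      (\<Sum>m'<n ^ d. ?q j m' * (?A j (?y m') * F (?y m')))) / 2 =
      ?W * (?A j \<eta> * partial_deriv j F \<eta> + F \<eta> / 2 * partial_deriv j (?A j) \<eta>)"
      unfolding tp_Q_exact[OF sbp F' j m] tp_Q_exact[OF sbp AF j m] \<eta>_def[symmetric]
        partial_deriv_mult[OF A F \<eta> j]
      by (simp add: algebra_simps)
  qed
  also have "\<dots> = ?W * ((\<Sum>j<d. ?A j \<eta> * partial_deriv j F \<eta>) +
      F \<eta> / 2 * (\<Sum>j<d. partial_deriv j (?A j) \<eta>))"
    by (simp only: sum_distrib_left sum.distrib distrib_left)
  also have "\<dots> = ?W * (\<Sum>j<d. ?A j \<eta> * partial_deriv j F \<eta>)"
    by (simp only: metric_identity[OF \<eta> i] mult_zero_right add_0_right)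
  also have "(\<Sum>j<d. ?A j \<eta> * partial_deriv j F \<eta>) =
      (\<Sum>j<d. \<Sum>r<d. partial_deriv r f (sub_map d P \<eta>) * (map_deriv d P {j} r \<eta> * ?A j \<eta>))"
    by (rule sum.cong[OF refl])
       (simp add: F_def[abs_def] partial_deriv_pullback[OF f \<eta>] sum_distrib_left mult_ac)
  also have "\<dots> = (\<Sum>r<d. partial_deriv r f (sub_map d P \<eta>) * (\<Sum>j<d. map_deriv d P {j} r \<eta> * ?A j \<eta>))"
    by (subst sum.swap) (simp only: sum_distrib_left)
  also have "\<dots> = (\<Sum>r<d. if r = i then partial_deriv r f (sub_map d P \<eta>) * jac_det d P \<eta> else 0)"
    by (rule sum.cong[OF refl]) (simp add: metric_poly_jacobian[OF \<eta> i])
  also have "\<dots> = partial_deriv i f (sub_map d P \<eta>) * jac_det d P \<eta>"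
    using i by simp
  finally show ?thesis
    using m by (simp add: F_def \<eta>_def sub_H_def mat_diag_def mult_ac)
qed

section \<open>Assembly\<close>

lemma assemble_carrier: "assemble d n x P np X M \<in> carrier_mat np np"
  by (simp add: assemble_def mat_sum_def)

lemma assemble_index:
  assumes "a < np" "b < np"
  shows "assemble d n x P np X M $$ (a, b) = (\<Sum>l\<le>d. \<Sum>i<n ^ d. \<Sum>j<n ^ d.
    M (P l) $$ (i, j) * of_bool (X a = sub_map d (P l) (cube_node d n x i) \<and> X b = sub_map d (P l) (cube_node d n x j)))"
proof -
  have "assemble d n x P np X M $$ (a, b) = (\<Sum>(l, i, j)\<in>{..d} \<times> {..<n ^ d} \<times> {..<n ^ d}.
    M (P l) $$ (i, j) * of_bool (X a = sub_map d (P l) (cube_node d n x i) \<and> X b = sub_map d (P l) (cube_node d n x j)))"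
    unfolding assemble_def mat_sum_def using assms
    by (auto simp: assembly_Z_def intro!: sum.cong)
  then show ?thesis by (simp only: sum.cartesian_product)
qed

text \<open>Each local node is exactly one global node, so summing over global columns returns the local rows.\<close>

lemma assemble_row_sum:
  assumes X: "bij_betw X {..<np} (tpss_nodes d n x P)" and a: "a < np"
  shows "(\<Sum>b<np. assemble d n x P np X M $$ (a, b) * u (X b)) =
    (\<Sum>l\<le>d. \<Sum>i<n ^ d. of_bool (X a = sub_map d (P l) (cube_node d n x i)) *
      (\<Sum>j<n ^ d. M (P l) $$ (i, j) * u (sub_map d (P l) (cube_node d n x j))))"
proof -
  define y where "y l i = sub_map d (P l) (cube_node d n x i)" for l i
  have pick: "(\<Sum>b<np. of_bool (X b = y l j) * u (X b)) = u (y l j)" if "l \<le> d" "j < n ^ d" for l j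
  proof -
    have "y l j \<in> X ` {..<np}"
      using bij_betw_imp_surj_on[OF X] that by (auto simp: y_def tpss_nodes_def sub_nodes_def)
    then obtain b where b: "b < np" "y l j = X b" by auto
    have "(\<Sum>b'<np. of_bool (X b' = y l j) * u (X b')) = (\<Sum>b'\<in>{b}. of_bool (X b' = y l j) * u (X b'))"
      by (rule sum.mono_neutral_right)
         (use b inj_onD[OF bij_betw_imp_inj_on[OF X]] in auto)
    then show ?thesis using b by simp
  qed
  have "(\<Sum>b<np. assemble d n x P np X M $$ (a, b) * u (X b)) = (\<Sum>b<np. \<Sum>l\<le>d. \<Sum>i<n ^ d. \<Sum>j<n ^ d.
    of_bool (X a = y l i) * (M (P l) $$ (i, j) * (of_bool (X b = y l j) * u (X b))))"
  proof (rule sum.cong[OF refl])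
    fix b assume "b \<in> {..<np}"
    then have b: "b < np" by simp
    show "assemble d n x P np X M $$ (a, b) * u (X b) = (\<Sum>l\<le>d. \<Sum>i<n ^ d. \<Sum>j<n ^ d.
      of_bool (X a = y l i) * (M (P l) $$ (i, j) * (of_bool (X b = y l j) * u (X b))))"
      unfolding assemble_index[OF a b] y_def[symmetric] of_bool_conj sum_distrib_right
      by (intro sum.cong refl) (simp only: mult_ac)
  qed
  also have "\<dots> = (\<Sum>l\<le>d. \<Sum>i<n ^ d. \<Sum>j<n ^ d. \<Sum>b<np.
    of_bool (X a = y l i) * (M (P l) $$ (i, j) * (of_bool (X b = y l j) * u (X b))))"
    by (simp only: sum.swap[of _ _ "{..<np}"])
  also have "\<dots> = (\<Sum>l\<le>d. \<Sum>i<n ^ d. of_bool (X a = y l i) * (\<Sum>j<n ^ d. M (P l) $$ (i, j) * u (y l j)))"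
    unfolding sum_distrib_left[symmetric]
    by (intro sum.cong refl arg_cong2[where f = "(*)"]) (simp only: pick atMost_iff lessThan_iff)
  finally show ?thesis unfolding y_def .
qed

lemma tpss_H_diagonal:
  assumes X: "bij_betw X {..<np} (tpss_nodes d n x P)"
  shows "diagonal_mat (tpss_H d n x H P np X)"
  unfolding diagonal_mat_def
proof (intro allI impI)
  fix a b assume "a < dim_row (tpss_H d n x H P np X)" "b < dim_col (tpss_H d n x H P np X)" and neq: "a \<noteq> b"
  then have ab: "a < np" "b < np"
    unfolding tpss_H_def using carrier_matD[OF assemble_carrier] by metis+
  then have "X a \<noteq> X b"
    using neq inj_onD[OF bij_betw_imp_inj_on[OF X]] by auto
  then show "tpss_H d n x H P np X $$ (a, b) = 0"
    unfolding tpss_H_def assemble_index[OF ab]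
    by (intro sum.neutral ballI) (auto simp: sub_H_def mat_diag_def)
qed

text \<open>For a diagonal matrix the diagonal entry is the row sum, which \<open>assemble_row_sum\<close> computes for the
  constant function \<open>1\<close>.\<close>

lemma tpss_H_entry:
  assumes X: "bij_betw X {..<np} (tpss_nodes d n x P)" and a: "a < np"
  shows "tpss_H d n x H P np X $$ (a, a) = (\<Sum>l\<le>d. \<Sum>i<n ^ d.
    of_bool (X a = sub_map d (P l) (cube_node d n x i)) * sub_H d n x H (P l) $$ (i, i))"
proof -
  have C: "tpss_H d n x H P np X \<in> carrier_mat np np"
    unfolding tpss_H_def by (rule assemble_carrier)
  have S: "(\<Sum>j<n ^ d. sub_H d n x H (P l) $$ (i, j) * 1) = sub_H d n x H (P l) $$ (i, i) * 1" if "i < n ^ d" for l i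
    by (rule diagonal_row_sum) (use that in \<open>auto simp: sub_H_def mat_diag_def diagonal_mat_def\<close>)
  have "tpss_H d n x H P np X $$ (a, a) * 1 = (\<Sum>b<np. tpss_H d n x H P np X $$ (a, b) * 1)"
    by (rule diagonal_row_sum[OF C tpss_H_diagonal[OF X] a, symmetric])
  also have "\<dots> = (\<Sum>l\<le>d. \<Sum>i<n ^ d. of_bool (X a = sub_map d (P l) (cube_node d n x i)) *
      (\<Sum>j<n ^ d. sub_H d n x H (P l) $$ (i, j) * 1))"
    unfolding tpss_H_def by (rule assemble_row_sum[OF X a])
  also have "\<dots> = (\<Sum>l\<le>d. \<Sum>i<n ^ d. of_bool (X a = sub_map d (P l) (cube_node d n x i)) *
      (sub_H d n x H (P l) $$ (i, i) * 1))"
    by (intro sum.cong refl) (simp only: S lessThan_iff)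
  finally show ?thesis by simp
qed

text \<open>Some local node is located at the global node \<open>a\<close>, since only nodes of subdomains are numbered.\<close>

lemma tpss_H_positive:
  assumes X: "bij_betw X {..<np} (tpss_nodes d n x P)" and a: "a < np"
    and pos: "\<And>l i. \<lbrakk>l \<le> d; i < n ^ d\<rbrakk> \<Longrightarrow> 0 < sub_H d n x H (P l) $$ (i, i)"
  shows "0 < tpss_H d n x H P np X $$ (a, a)"
proof -
  have "X a \<in> tpss_nodes d n x P"
    using bij_betwE[OF X] a by blast
  then obtain l i where li: "l \<le> d" "i < n ^ d" "X a = sub_map d (P l) (cube_node d n x i)"
    by (auto simp: tpss_nodes_def sub_nodes_def)
  have nonneg: "0 \<le> of_bool (X a = sub_map d (P l) (cube_node d n x i)) * sub_H d n x H (P l) $$ (i, i)"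
    if "l \<le> d" "i < n ^ d" for l i
    using pos[OF that] by simp
  have "0 < (\<Sum>i<n ^ d. of_bool (X a = sub_map d (P l) (cube_node d n x i)) * sub_H d n x H (P l) $$ (i, i))"
    by (rule sum_pos2[of _ i]) (use li pos[OF li(1,2)] nonneg in auto)
  then show ?thesis
    unfolding tpss_H_entry[OF X a]
  proof (rule sum_pos2[rotated 2])
    show "0 \<le> (\<Sum>i<n ^ d. of_bool (X a = sub_map d (P l) (cube_node d n x i)) * sub_H d n x H (P l) $$ (i, i))"
      if "l \<in> {..d}" for l
      by (rule sum_nonneg) (use that nonneg in blast)
  qed (use li(1) in simp_all)
qed

text \<open>The local identities \<open>Q f = H (\<partial>f)\<close> add up, because \<open>\<partial>f\<close> takes the same value at all local nodes
  with the same image.\<close>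

lemma tpss_D_exact:
  assumes sbp: "sbp_1d p n x H Q" and X: "bij_betw X {..<np} (tpss_nodes d n x P)"
    and jac: "\<And>l m. \<lbrakk>l \<le> d; m < n ^ d\<rbrakk> \<Longrightarrow> 0 < jac_det d (P l) (cube_node d n x m)"
    and i: "i < d" and f: "f \<in> poly_space d k" and k: "k + (d - 1) \<le> p"
  shows "tpss_D d n x H Q P np X i *\<^sub>v vec np (\<lambda>a. f (X a)) = vec np (\<lambda>a. partial_deriv i f (X a))"
proof -
  note sbp' = sbp_1d_entrywise[OF sbp]
  let ?y = "\<lambda>l m. sub_map d (P l) (cube_node d n x m)"
  have pos: "0 < sub_H d n x H (P l) $$ (m, m)" if "l \<le> d" "m < n ^ d" for l m
  proof -
    have "0 < (\<Prod>k<d. H $$ (digit n m k, digit n m k))"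
      using sbp'(3) digit_less base_pos[OF that(2)] by (intro prod_pos) blast
    then show ?thesis
      using jac[OF that] that(2) by (simp add: sub_H_def mat_diag_def tp_H_index[OF sbp'(1)])
  qed
  have C: "tpss_H d n x H P np X \<in> carrier_mat np np" "tpss_Q d n x H Q P np X i \<in> carrier_mat np np"
    unfolding tpss_H_def tpss_Q_def by (rule assemble_carrier)+
  have nz: "tpss_H d n x H P np X $$ (a, a) \<noteq> 0" if "a < np" for a
    using tpss_H_positive[OF X that, of H] pos by force
  have "(\<Sum>b<np. tpss_Q d n x H Q P np X i $$ (a, b) * f (X b)) =
    tpss_H d n x H P np X $$ (a, a) * partial_deriv i f (X a)" if a: "a < np" for a
  proof -
    have "(\<Sum>b<np. tpss_Q d n x H Q P np X i $$ (a, b) * f (X b)) = (\<Sum>l\<le>d. \<Sum>m<n ^ d.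
      of_bool (X a = ?y l m) * (\<Sum>m'<n ^ d. sub_Q d n x H Q (P l) i $$ (m, m') * f (?y l m')))"
      unfolding tpss_Q_def by (rule assemble_row_sum[OF X a])
    also have "\<dots> = (\<Sum>l\<le>d. \<Sum>m<n ^ d. of_bool (X a = ?y l m) * sub_H d n x H (P l) $$ (m, m) * partial_deriv i f (X a))"
    proof (intro sum.cong refl)
      fix l m assume "l \<in> {..d}" "m \<in> {..<n ^ d}"
      then have lm: "l \<le> d" "m < n ^ d" by simp_all
      have "(\<Sum>m'<n ^ d. sub_Q d n x H Q (P l) i $$ (m, m') * f (?y l m')) =
        sub_H d n x H (P l) $$ (m, m) * partial_deriv i f (?y l m)"
        by (rule sub_Q_exact[OF sbp i f k _ lm(2)]) (use jac[OF lm(1)] in force)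
      then show "of_bool (X a = ?y l m) * (\<Sum>m'<n ^ d. sub_Q d n x H Q (P l) i $$ (m, m') * f (?y l m')) =
        of_bool (X a = ?y l m) * sub_H d n x H (P l) $$ (m, m) * partial_deriv i f (X a)"
        by (cases "X a = ?y l m") (simp_all only: of_bool_eq mult_zero_left mult_1_left)
    qed
    also have "\<dots> = tpss_H d n x H P np X $$ (a, a) * partial_deriv i f (X a)"
      by (simp only: tpss_H_entry[OF X a] sum_distrib_right)
    finally show ?thesis .
  qed
  then show ?thesis
    unfolding tpss_D_def by (subst diagonal_inv_mult_vec_iff[OF C(1) tpss_H_diagonal[OF X] _ C(2)]) (use nz in auto)
qed

theorem theorem3:
  fixes d p n np :: nat
    and x :: "real vec"
    and H1 Q1 :: "real mat"
    and P :: "nat \<Rightarrow> real vec \<Rightarrow> real vec"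
    and X :: "nat \<Rightarrow> real vec"
  assumes "d \<in> {2, 3}"
    and "d - 1 \<le> p"
    and "sbp_1d p n x H1 Q1"
    and "vertex_matching d n x P"
    and "conforming d n x P"
    and "bij_betw X {..<np} (tpss_nodes d n x P)"
  shows "\<forall>i<d. \<forall>f\<in>poly_space d (p + 1 - d). \<forall>m<np.
    (tpss_D d n x H1 Q1 P np X i *\<^sub>v vec np (\<lambda>k. f (X k))) $ m = partial_deriv i f (X m)"
proof (intro allI impI ballI)
  fix i f m assume i: "i < d" and f: "f \<in> poly_space d (p + 1 - d)" and m: "m < np"
  have "tpss_D d n x H1 Q1 P np X i *\<^sub>v vec np (\<lambda>k. f (X k)) = vec np (\<lambda>k. partial_deriv i f (X k))"
  proof (rule tpss_D_exact[OF assms(3,6) _ i f])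
    show "0 < jac_det d (P l) (cube_node d n x m)" if "l \<le> d" "m < n ^ d" for l m
      using assms(4) that by (simp add: vertex_matching_def)
    show "p + 1 - d + (d - 1) \<le> p"
      using assms(1,2) by auto
  qed
  then show "(tpss_D d n x H1 Q1 P np X i *\<^sub>v vec np (\<lambda>k. f (X k))) $ m = partial_deriv i f (X m)"
    using m by simp
qed

end
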